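(* Let $R$ be a rule set in which pairs of types $THTH$ and $HTHT$ both nest and pairs of types $HTTH$ and $THHT$ both cross, and let $\Delta_n=\Delta_n(R)$, $n\ge 0$ (assumed to be triangulations of $\partial P_n$ for $n\ge1$). Then the generating function of saturated faces satisfies $$F(\widehat{\mathcal F},x,y,z)=1+\sum_{a,b\ge0}\bigl(xD_{a,b}(x)+yD_{a,b}(y)\bigr)z^{a+b+1}+xy\sum_{a',b',a'',b''\ge0}D_{a',b'}(x)\,D_{a'',b''}(y)\,z^{a'+b'+a''+b''+2}\,C(a',b',a'',b'',z),$$ where $$C(a',b',a'',b'',z)=\binom{a'+b''+2}{a'+1}\binom{a''+b'+2}{b'+1}z+\binom{a'+b''+1}{b''}\binom{a''+b'+1}{b'}+\binom{a'+b''+1}{a'}\binom{a''+b'+1}{a''}.$$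
   Context: $P_n$ is the convex hull of $e_j-e_i$ ($i\ne j$) in $\mathbb{R}^{n+1}$. An arrow $(i,j)$, $i\ne j\in\{1,\dots,n+1\}$, has tail $i$ and head $j$; forward if $i<j$, backward if $i>j$; $V_n$ is the set of arrows ($V_0=\emptyset$). For two arrows with four distinct endpoints $p_1<\dots<p_4$, the type is the $T/H$ word recording tails/heads at $p_1,\dots,p_4$; the tails and heads can be matched in two ways: for types $THTH,HTHT$ one of them nests (joins $\{p_1,p_4\},\{p_2,p_3\}$), for $THHT,HTTH$ one crosses (joins $\{p_1,p_3\},\{p_2,p_4\}$), for $TTHH,HHTT$ one nests and one crosses. A rule set $R$ chooses for each of the six types which matching is an edge. $\Delta_n(R)$ is the flag complex on $V_n$ whose edges are the pairs of distinct arrows with a common tail, those with a common head, and pairs with four distinct endpoints equal to the matching chosen by $R$ for their type; $\Delta_0=\{\emptyset\}$. For $n\ge1$, $\sigma\subseteq V_n$ is saturated if the endpoints of its arrows are exactly $\{1,\dots,n+1\}$; the empty subset of $V_0$ is saturated. $F(\widehat{\mathcal F},x,y,z)=\sum_{n\ge0}\sum_\sigma x^{\#\text{forward arrows of }\sigma}y^{\#\text{backward arrows of }\sigma}z^n$, over saturated faces $\sigma$ of $\Delta_n$. The Delannoy polynomial $D_{a,b}(x)$ is the sum over all lattice paths from $(0,0)$ to $(a,b)$ with steps $(0,1),(1,0),(1,1)$ of $x^{\#\text{steps}}$. *)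

theory Defs
  imports "HOL-Analysis.Analysis" "HOL-Analysis.Finite_Function_Topology"
begin

(* The arrow with tail i and head j is the pair (i, j). *)
type_synonym arrow = "nat \<times> nat"

abbreviation (input) tail :: "arrow \<Rightarrow> nat" where "tail \<equiv> fst"
abbreviation (input) head :: "arrow \<Rightarrow> nat" where "head \<equiv> snd"

definition endpoints :: "arrow \<Rightarrow> nat set" where
  "endpoints a = {tail a, head a}"

definition forward :: "arrow \<Rightarrow> bool" where
  "forward a \<longleftrightarrow> tail a < head a"

definition backward :: "arrow \<Rightarrow> bool" where
  "backward a \<longleftrightarrow> tail a > head a"

definition arrows :: "nat \<Rightarrow> arrow set" where
  "arrows n = {(i, j). i \<in> {1..n+1} \<and> j \<in> {1..n+1} \<and> i \<noteq> j}"


(* All R^(n+1) are placed in the single space of finitely supported functions nat => real, as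
   the coordinate subspaces on 1, ..., n+1; this allows quantification over n inside a formula. *)

definition unit_vec :: "nat \<Rightarrow> (nat \<Rightarrow>\<^sub>0 real)" where
  "unit_vec i = Poly_Mapping.single i 1"

definition arrow_point :: "arrow \<Rightarrow> (nat \<Rightarrow>\<^sub>0 real)" where
  "arrow_point a = unit_vec (head a) - unit_vec (tail a)"

definition legendre_polytope :: "nat \<Rightarrow> (nat \<Rightarrow>\<^sub>0 real) set" where
  "legendre_polytope n = convex hull (arrow_point ` arrows n)"

(* The library notion of triangulation is confined to the class euclidean_space, to which the
   ambient space above does not belong. Here an abstract simplicial complex K, with vertices
   placed by p, is a triangulation of the point set X. *)
definition triangulates ::
    "'v set set \<Rightarrow> ('v \<Rightarrow> 'a::real_vector) \<Rightarrow> 'a set \<Rightarrow> bool" where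
  "triangulates K p X \<longleftrightarrow>
     (\<forall>\<sigma>\<in>K. finite \<sigma> \<and> inj_on p \<sigma> \<and> \<not> affine_dependent (p ` \<sigma>)) \<and>
     (\<forall>\<sigma>\<in>K. \<forall>\<tau>. \<tau> \<subseteq> \<sigma> \<longrightarrow> \<tau> \<in> K) \<and>
     (\<forall>\<sigma>\<in>K. \<forall>\<tau>\<in>K. convex hull (p ` \<sigma>) \<inter> convex hull (p ` \<tau>) = convex hull (p ` (\<sigma> \<inter> \<tau>))) \<and>
     (\<Union>\<sigma>\<in>K. convex hull (p ` \<sigma>)) = X"


datatype arrow_end = Tail | Head

(* The three perfect matchings of four points p1 < p2 < p3 < p4:
   Nest     joins p1 with p4 and p2 with p3,
   Cross    joins p1 with p3 and p2 with p4,
   Separate joins p1 with p2 and p3 with p4. *)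
datatype pattern = Nest | Cross | Separate

fun matching :: "pattern \<Rightarrow> 'a list \<Rightarrow> 'a set set" where
  "matching Nest ps = {{ps ! 0, ps ! 3}, {ps ! 1, ps ! 2}}"
| "matching Cross ps = {{ps ! 0, ps ! 2}, {ps ! 1, ps ! 3}}"
| "matching Separate ps = {{ps ! 0, ps ! 1}, {ps ! 2, ps ! 3}}"

definition pair_types :: "arrow_end list set" where
  "pair_types = {w. length w = 4 \<and> count_list w Tail = 2 \<and> count_list w Head = 2}"

(* For each of the six types, exactly two of the three patterns match tails with heads;
   a rule set picks one of them. Values outside pair_types play no role. *)
definition rule_set :: "(arrow_end list \<Rightarrow> pattern) \<Rightarrow> bool" where
  "rule_set R \<longleftrightarrow>
     (\<forall>w\<in>pair_types. \<forall>B\<in>matching (R w) [0, 1, 2, 3 :: nat].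
        \<exists>s t. B = {s, t} \<and> w ! s = Tail \<and> w ! t = Head)"

definition ends_sorted :: "arrow \<Rightarrow> arrow \<Rightarrow> nat list" where
  "ends_sorted a b = sorted_list_of_set (endpoints a \<union> endpoints b)"

definition pair_type :: "arrow \<Rightarrow> arrow \<Rightarrow> arrow_end list" where
  "pair_type a b = map (\<lambda>p. if p \<in> {tail a, tail b} then Tail else Head) (ends_sorted a b)"

definition edge :: "(arrow_end list \<Rightarrow> pattern) \<Rightarrow> arrow \<Rightarrow> arrow \<Rightarrow> bool" where
  "edge R a b \<longleftrightarrow> a \<noteq> b \<and>
     (tail a = tail b \<or> head a = head b \<or>
      card (endpoints a \<union> endpoints b) = 4 \<and>
      {endpoints a, endpoints b} = matching (R (pair_type a b)) (ends_sorted a b))"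

definition Delta :: "(arrow_end list \<Rightarrow> pattern) \<Rightarrow> nat \<Rightarrow> arrow set set" where
  "Delta R n = {\<sigma>. \<sigma> \<subseteq> arrows n \<and> (\<forall>a\<in>\<sigma>. \<forall>b\<in>\<sigma>. a \<noteq> b \<longrightarrow> edge R a b)}"

definition saturated :: "nat \<Rightarrow> arrow set \<Rightarrow> bool" where
  "saturated n \<sigma> \<longleftrightarrow> (if n = 0 then \<sigma> = {} else (\<Union>a\<in>\<sigma>. endpoints a) = {1..n+1})"

definition saturated_faces :: "(arrow_end list \<Rightarrow> pattern) \<Rightarrow> nat \<Rightarrow> arrow set set" where
  "saturated_faces R n = {\<sigma> \<in> Delta R n. saturated n \<sigma>}"

(* A formal power series in z; x and y range over an arbitrary commutative ring, which covers
   the case of two indeterminates. *)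
definition arrow_gf ::
    "(nat \<Rightarrow> arrow set set) \<Rightarrow> 'a::comm_ring_1 \<Rightarrow> 'a \<Rightarrow> 'a fps" where
  "arrow_gf \<F> x y =
     Abs_fps (\<lambda>n. \<Sum>\<sigma>\<in>\<F> n. x ^ card {a \<in> \<sigma>. forward a} * y ^ card {a \<in> \<sigma>. backward a})"


definition delannoy_paths :: "nat \<Rightarrow> nat \<Rightarrow> (nat \<times> nat) list set" where
  "delannoy_paths a b = {s. set s \<subseteq> {(0, 1), (1, 0), (1, 1)} \<and> sum_list s = (a, b)}"

definition delannoy :: "nat \<Rightarrow> nat \<Rightarrow> 'a::comm_ring_1 \<Rightarrow> 'a" where
  "delannoy a b x = (\<Sum>s\<in>delannoy_paths a b. x ^ length s)"

definition mixed_factor :: "nat \<Rightarrow> nat \<Rightarrow> nat \<Rightarrow> nat \<Rightarrow> 'a::comm_ring_1 fps" where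
  "mixed_factor a' b' a'' b'' =
     of_nat ((a' + b'' + 2) choose (a' + 1)) * of_nat ((a'' + b' + 2) choose (b' + 1)) * fps_X
     + of_nat ((a' + b'' + 1) choose b'') * of_nat ((a'' + b' + 1) choose b')
     + of_nat ((a' + b'' + 1) choose a') * of_nat ((a'' + b' + 1) choose a'')"

end

theory Submission
  imports Defs
begin

text \<open>In a face every vertex is only a tail or only a head. Two forward arrows without a common
  endpoint span an edge only if both tails precede both heads, and two backward arrows only if both
  heads precede both tails; whichever matching is chosen for these two types, the forward arrows
  (and likewise the backward arrows) form a staircase between their tails and their heads, so by
  deleting its extreme corner they are counted by \<open>x D\<^sub>a\<^sub>,\<^sub>b(x)\<close>. A forward and a backward arrow without a
  common endpoint span an edge precisely when the intervals they cover overlap. Hence every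
  forward tail and backward head lies weakly to the left of every forward head and backward tail.
  These left and right sets partition the vertices (the first binomial term), except that they may
  have one vertex in common, which is then a common head or a common tail (the other two terms).
  The forward and backward staircases can be chosen independently.\<close>

subsection \<open>Edges\<close>

lemma ends_sorted_4:
  assumes "endpoints a \<union> endpoints b = {p1, p2, p3, p4}" "p1 < p2" "p2 < p3" "p3 < p4"
  shows "ends_sorted a b = [p1, p2, p3, p4]"
proof -
  have "sorted_list_of_set (set [p1, p2, p3, p4]) = [p1, p2, p3, p4]"
    using assms(2-) by (subst sorted_list_of_set.idem_if_sorted_distinct) auto
  then show ?thesis
    using assms(1) by (simp add: ends_sorted_def)
qed

lemma edge_sym: "edge R a b \<longleftrightarrow> edge R b a"
proof -
  have s: "endpoints a \<union> endpoints b = endpoints b \<union> endpoints a"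
    "{endpoints a, endpoints b} = {endpoints b, endpoints a}" by auto
  then have "pair_type a b = pair_type b a" "ends_sorted a b = ends_sorted b a"
    by (auto simp: pair_type_def ends_sorted_def)
  with s show ?thesis unfolding edge_def by metis
qed

text \<open>Distinct tails and distinct heads exclude the first two kinds of edge, so once the
  sorted endpoints are known, being an edge is a finite check on the word of the type.\<close>

lemma edge_4:
  assumes "endpoints a \<union> endpoints b = {p1, p2, p3, p4}" "p1 < p2" "p2 < p3" "p3 < p4"
    and "tail a \<noteq> tail b" "head a \<noteq> head b"
  shows "edge R a b \<longleftrightarrow>
    {endpoints a, endpoints b} =
      matching (R (map (\<lambda>p. if p \<in> {tail a, tail b} then Tail else Head) [p1, p2, p3, p4]))
        [p1, p2, p3, p4]"
proof -
  have "card (endpoints a \<union> endpoints b) = 4"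
    using assms by simp
  moreover have "a \<noteq> b" using assms by auto
  ultimately show ?thesis
    unfolding edge_def pair_type_def ends_sorted_4[OF assms(1-4)] using assms(5,6) by simp
qed

text \<open>An edge with neither tail nor head in common needs four distinct endpoints; a tail equal
  to a head would leave at most three.\<close>

lemma edge_degenerate:
  assumes "tail a \<noteq> tail b" "head a \<noteq> head b" "edge R a b"
  shows "tail a \<noteq> head b" "head a \<noteq> tail b"
proof -
  have c: "card {tail a, head a, tail b, head b} = 4"
    using assms by (simp add: edge_def endpoints_def insert_commute)
  show "tail a \<noteq> head b"
  proof
    assume "tail a = head b"
    then have "{tail a, head a, tail b, head b} = set [head a, tail b, head b]" by auto
    then show False using c card_length[of "[head a, tail b, head b]"] by simp
  qed
  show "head a \<noteq> tail b"
  proof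
    assume "head a = tail b"
    then have "{tail a, head a, tail b, head b} = set [tail a, tail b, head b]" by auto
    then show False using c card_length[of "[tail a, tail b, head b]"] by simp
  qed
qed

text \<open>\<open>Separate\<close> would join positions 0 and 1, which carry the same letter. Hence
  only \<open>Nest\<close> and \<open>Cross\<close> remain for the two types whose rule is left
  open.\<close>

lemma rule_set_TTHH:
  assumes "rule_set R" "e \<noteq> e'"
  shows "R [e, e, e', e'] \<noteq> Separate"
proof
  assume "R [e, e, e', e'] = Separate"
  then have "{0, 1} \<in> matching (R [e, e, e', e']) [0, 1, 2, 3 :: nat]" by simp
  moreover have "[e, e, e', e'] \<in> pair_types"
    using assms(2) by (cases e; cases e') (auto simp: pair_types_def)
  ultimately obtain s t where "{0, 1} = {s, t}" "[e, e, e', e'] ! s = Tail" "[e, e, e', e'] ! t = Head"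
    using assms(1) unfolding rule_set_def by blast
  then show False by (auto simp: doubleton_eq_iff)
qed

text \<open>Crossing arrows preserve and nesting arrows reverse the order from tails to heads.\<close>

definition orientation :: "pattern \<Rightarrow> nat \<Rightarrow> int" where
  "orientation p k = (if p = Cross then int k else - int k)"

lemma inj_orientation: "inj (orientation p)"
  by (auto simp: orientation_def inj_on_def)

section \<open>Edge criteria by the directions of the two arrows\<close>

locale nest_cross_rules =
  fixes R :: "arrow_end list \<Rightarrow> pattern"
  assumes rule_set: "rule_set R"
    and THTH: "R [Tail, Head, Tail, Head] = Nest" and HTHT: "R [Head, Tail, Head, Tail] = Nest"
    and HTTH: "R [Head, Tail, Tail, Head] = Cross" and THHT: "R [Tail, Head, Head, Tail] = Cross"
begin

text \<open>Arrows over disjoint intervals have type THTH and are matched separately, while the rule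
  nests. If both tails precede both heads, the type is TTHH, where \<open>Cross\<close> asks for
  \<open>h < h'\<close> and \<open>Nest\<close> for \<open>h' < h\<close>. With a common head both
  sides hold; with \<open>h = t'\<close> both fail.\<close>

lemma edge_forward_forward_aux:
  assumes "t < h" "t' < h'" "t < t'"
  shows "edge R (t, h) (t', h') \<longleftrightarrow> t' < h \<and>
    orientation (R [Tail, Tail, Head, Head]) h \<le> orientation (R [Tail, Tail, Head, Head]) h'"
proof -
  consider "h = h'" | "h = t'" | "h < t'" | "t' < h" "h < h'" | "h' < h" using assms by linarith
  then show ?thesis
  proof cases
    case 1 then show ?thesis using assms by (auto simp: edge_def)
  next
    case 2 then show ?thesis using assms edge_degenerate[of "(t, h)" "(t', h')" R] by auto
  next
    case 3
    then show ?thesis using assms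
      by (subst edge_4[of _ _ t h t' h'])
        (auto simp: endpoints_def THTH doubleton_eq_iff)
  next
    case 4
    then show ?thesis using assms rule_set_TTHH[OF rule_set arrow_end.distinct(1)]
      by (subst edge_4[of _ _ t t' h h'])
        (cases "R [Tail, Tail, Head, Head]"; auto simp: endpoints_def doubleton_eq_iff orientation_def)+
  next
    case 5
    then show ?thesis using assms rule_set_TTHH[OF rule_set arrow_end.distinct(1)]
      by (subst edge_4[of _ _ t t' h' h])
        (cases "R [Tail, Tail, Head, Head]"; auto simp: endpoints_def doubleton_eq_iff orientation_def)+
  qed
qed

text \<open>The mirror image of the forward case: heads now lie on the left, so disjoint intervals
  give type HTHT and overlapping ones type HHTT.\<close>

lemma edge_backward_backward_aux:
  assumes "h < t" "h' < t'" "t < t'"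
  shows "edge R (t, h) (t', h') \<longleftrightarrow> h' < t \<and>
    orientation (R [Head, Head, Tail, Tail]) h \<le> orientation (R [Head, Head, Tail, Tail]) h'"
proof -
  consider "h = h'" | "h' = t" | "h' > t" | "h' < t" "h < h'" | "h' < h" using assms by linarith
  then show ?thesis
  proof cases
    case 1 then show ?thesis using assms by (auto simp: edge_def)
  next
    case 2 then show ?thesis using assms edge_degenerate[of "(t, h)" "(t', h')" R] by auto
  next
    case 3
    then show ?thesis using assms
      by (subst edge_4[of _ _ h t h' t'])
        (auto simp: endpoints_def HTHT doubleton_eq_iff)
  next
    case 4
    then show ?thesis using assms rule_set_TTHH[OF rule_set arrow_end.distinct(2)]
      by (subst edge_4[of _ _ h h' t t'])
        (cases "R [Head, Head, Tail, Tail]"; auto simp: endpoints_def doubleton_eq_iff orientation_def)+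
  next
    case 5
    then show ?thesis using assms rule_set_TTHH[OF rule_set arrow_end.distinct(2)]
      by (subst edge_4[of _ _ h' h t t'])
        (cases "R [Head, Head, Tail, Tail]"; auto simp: endpoints_def doubleton_eq_iff orientation_def)+
  qed
qed

text \<open>With four distinct endpoints such a pair has type THTH, HTHT, THHT or HTTH, and it is
  matched separately exactly when its intervals are disjoint. None of these four rules is
  \<open>Separate\<close>, so overlap, expressed by \<open>t < t'\<close> and \<open>h' < h\<close>,
  is the whole condition.\<close>

lemma edge_forward_backward:
  assumes "t < h" "h' < t'"
  shows "edge R (t, h) (t', h') \<longleftrightarrow> t = t' \<or> h = h' \<or>
    t \<noteq> h' \<and> h \<noteq> t' \<and> t < t' \<and> h' < h"
proof -
  consider "t = t'" | "h = h'" | "t \<noteq> t'" "h \<noteq> h'" "t = h' \<or> h = t'" | "h < h'" | "t' < t"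
    | "t < h'" "h' < h" "h < t'" | "t < h'" "t' < h"
    | "h' < t" "h < t'" | "h' < t" "t < t'" "t' < h" using assms by linarith
  then show ?thesis
  proof cases
    case 1 then show ?thesis using assms by (auto simp: edge_def)
  next
    case 2 then show ?thesis using assms by (auto simp: edge_def)
  next
    case 3 then show ?thesis using assms edge_degenerate[of "(t, h)" "(t', h')" R] by auto
  next
    case 4
    then show ?thesis using assms
      by (subst edge_4[of _ _ t h h' t']) (auto simp: endpoints_def THHT doubleton_eq_iff)
  next
    case 5
    then show ?thesis using assms
      by (subst edge_4[of _ _ h' t' t h]) (auto simp: endpoints_def HTTH doubleton_eq_iff)
  next
    case 6
    then show ?thesis using assms
      by (subst edge_4[of _ _ t h' h t']) (auto simp: endpoints_def THHT doubleton_eq_iff)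
  next
    case 7
    then show ?thesis using assms
      by (subst edge_4[of _ _ t h' t' h]) (auto simp: endpoints_def THTH doubleton_eq_iff)
  next
    case 8
    then show ?thesis using assms
      by (subst edge_4[of _ _ h' t h t']) (auto simp: endpoints_def HTHT doubleton_eq_iff)
  next
    case 9
    then show ?thesis using assms
      by (subst edge_4[of _ _ h' t t' h]) (auto simp: endpoints_def HTTH doubleton_eq_iff)
  qed
qed

end

subsection \<open>Delannoy polynomials\<close>

text \<open>Split by the first step. The guards \<open>a > 0\<close> and \<open>b > 0\<close> keep
  truncated subtraction from producing spurious paths.\<close>

lemma delannoy_paths_rec:
  "delannoy_paths a b =
     (if a = 0 \<and> b = 0 then {[]} else {}) \<union>
     (if b > 0 then (#) (0, 1) ` delannoy_paths a (b - 1) else {}) \<union>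
     (if a > 0 then (#) (1, 0) ` delannoy_paths (a - 1) b else {}) \<union>
     (if a > 0 \<and> b > 0 then (#) (1, 1) ` delannoy_paths (a - 1) (b - 1) else {})"
  (is "?l = ?r")
proof (intro equalityI subsetI)
  fix s assume s: "s \<in> ?l"
  then show "s \<in> ?r"
  proof (cases s)
    case Nil
    with s show ?thesis by (auto simp: delannoy_paths_def zero_prod_def)
  next
    case (Cons p s')
    obtain c d where cd: "sum_list s' = (c, d)" by fastforce
    from s Cons cd have "s' \<in> delannoy_paths c d" "p + (c, d) = (a, b)"
      "p = (0, 1) \<or> p = (1, 0) \<or> p = (1, 1)"
      by (auto simp: delannoy_paths_def)
    with Cons show ?thesis by auto
  qed
next
  fix s assume "s \<in> ?r"
  then show "s \<in> ?l"
    by (auto simp: delannoy_paths_def zero_prod_def split: if_splits)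
qed

lemma finite_delannoy_paths: "finite (delannoy_paths a b)"
proof (induction "a + b" arbitrary: a b rule: less_induct)
  case less
  show ?case
    by (subst delannoy_paths_rec) (auto intro!: finite_imageI less)
qed

text \<open>The families in the recursion for paths are disjoint, as they differ in the first step,
  and prepending a step multiplies the weight by \<open>x\<close>.\<close>

lemma delannoy_rec:
  "delannoy a b x =
     (if a = 0 \<and> b = 0 then 1 else 0) + (if b > 0 then x * delannoy a (b - 1) x else 0) +
     (if a > 0 then x * delannoy (a - 1) b x else 0) +
     (if a > 0 \<and> b > 0 then x * delannoy (a - 1) (b - 1) x else 0)"
proof -
  have cons: "(\<Sum>s\<in>(#) p ` P. x ^ length s) = x * (\<Sum>s\<in>P. x ^ length s)"
    for p :: "nat \<times> nat" and P
    by (simp add: sum.reindex sum_distrib_left)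
  show ?thesis
    unfolding delannoy_def
    by (subst delannoy_paths_rec, subst sum.union_disjoint,
        (auto simp: finite_delannoy_paths)[3], subst sum.union_disjoint,
        (auto simp: finite_delannoy_paths)[3], subst sum.union_disjoint,
        (auto simp: finite_delannoy_paths)[3]) (auto simp: cons)
qed

subsection \<open>Staircases\<close>

text \<open>With \<open>g\<close> an \<open>orientation\<close>, both open rules are covered at
  once: \<open>snd\<close> weakly increases or weakly decreases along \<open>fst\<close>. Pairs with
  equal \<open>fst\<close> are unconstrained, as arrows with a common tail always span an edge.
  Domain and range are prescribed exactly, in view of saturation.\<close>

definition staircases :: "('b \<Rightarrow> int) \<Rightarrow> 'a::linorder set \<Rightarrow> 'b set \<Rightarrow> ('a \<times> 'b) set set" where
  "staircases g A B =
     {E. fst ` E = A \<and> snd ` E = B \<and> (\<forall>e\<in>E. \<forall>e'\<in>E. fst e < fst e' \<longrightarrow> g (snd e) \<le> g (snd e'))}"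

lemma staircases_subset: "E \<in> staircases g A B \<Longrightarrow> E \<subseteq> A \<times> B"
  by (force simp: staircases_def)

lemma staircases_image: "E \<in> staircases g A B \<Longrightarrow> fst ` E = A \<and> snd ` E = B"
  by (simp add: staircases_def)

lemma finite_staircases: "finite A \<Longrightarrow> finite B \<Longrightarrow> finite (staircases g A B)"
  by (rule finite_subset[of _ "Pow (A \<times> B)"]) (auto dest: staircases_subset)

lemma staircases_empty:
  "staircases g {} B = (if B = {} then {{}} else {})" "staircases g A {} = (if A = {} then {{}} else {})"
  by (auto simp: staircases_def)

text \<open>Every staircase contains the corner \<open>(M, m)\<close>, and once it is removed at most one of \<open>M\<close>
  and \<open>m\<close> still occurs.\<close>

lemma staircases_rec:
  assumes "inj g" "M \<in> A" "\<And>a. a \<in> A \<Longrightarrow> a \<le> M" "m \<in> B" "\<And>b. b \<in> B \<Longrightarrow> g b \<le> g m"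
  shows "staircases g A B = insert (M, m) `
    (staircases g (A - {M}) (B - {m}) \<union> staircases g (A - {M}) B \<union> staircases g A (B - {m}))"
    (is "_ = insert _ ` ?S")
proof (intro equalityI subsetI)
  fix E assume E: "E \<in> staircases g A B"
  then have EA: "fst ` E = A" and EB: "snd ` E = B"
    and ch: "\<forall>e\<in>E. \<forall>e'\<in>E. fst e < fst e' \<longrightarrow> g (snd e) \<le> g (snd e')"
    by (simp_all add: staircases_def)
  have chain: "g b \<le> g b'" if "(a, b) \<in> E" "(a', b') \<in> E" "a < a'" for a b a' b'
    using ch that by (metis fst_conv snd_conv)
  have memA: "a \<in> A" and memB: "b \<in> B" if "(a, b) \<in> E" for a b
    using EA EB that by force+
  \<comment> \<open>Injectivity of \<open>g\<close> makes \<open>m\<close> the only element of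
    \<open>B\<close> at which \<open>g\<close> is maximal.\<close>
  have meq: "b = m" if "b \<in> B" "g m \<le> g b" for b
    using assms(1) assms(5)[OF that(1)] that(2) by (simp add: inj_eq)
  obtain b0 a0 where b0: "(M, b0) \<in> E" and a0: "(a0, m) \<in> E"
    using EA EB assms(2,4) by force
  \<comment> \<open>Unless \<open>a0 = M\<close>, the pair \<open>(a0, m)\<close> comes strictly
    before \<open>(M, b0)\<close>, and the chain condition forces \<open>b0 = m\<close>.\<close>
  have Mm: "(M, m) \<in> E"
  proof (cases "a0 = M")
    case False
    then have "a0 < M" using assms(3)[OF memA[OF a0]] by simp
    then show ?thesis using chain[OF a0 b0] b0 meq[OF memB[OF b0]] by simp
  qed (use a0 in simp)
  define E' where "E' = E - {(M, m)}"
  have "E = insert (M, m) E'" using Mm by (auto simp: E'_def)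
  then have "A = insert M (fst ` E')" "B = insert m (snd ` E')" by (simp_all flip: EA EB)
  then have dom: "fst ` E' = A \<or> fst ` E' = A - {M}" "snd ` E' = B \<or> snd ` E' = B - {m}"
    by blast+
  \<comment> \<open>If both \<open>M\<close> and \<open>m\<close> survived, a pair
    \<open>(a1, m)\<close> would precede a pair \<open>(M, b1)\<close> with \<open>b1\<close>
    different from \<open>m\<close>, against the chain condition.\<close>
  have "\<not> (fst ` E' = A \<and> snd ` E' = B)"
  proof
    assume *: "fst ` E' = A \<and> snd ` E' = B"
    then have "M \<in> fst ` E'" "m \<in> snd ` E'" using assms(2,4) by auto
    then obtain b1 a1 where b1: "(M, b1) \<in> E'" and a1: "(a1, m) \<in> E'" by force
    then have E: "(M, b1) \<in> E" "b1 \<noteq> m" "(a1, m) \<in> E" "a1 \<noteq> M" by (auto simp: E'_def)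
    then have "a1 < M" using assms(3)[OF memA[OF E(3)]] by simp
    then have "g m \<le> g b1" using chain[OF E(3,1)] by simp
    then show False using meq[OF memB[OF E(1)]] E(2) by simp
  qed
  then have "E' \<in> ?S"
    using dom ch by (auto simp: staircases_def E'_def)
  then show "E \<in> insert (M, m) ` ?S"
    using Mm by (intro image_eqI[of _ _ E']) (auto simp: E'_def)
next
  fix E assume "E \<in> insert (M, m) ` ?S"
  then obtain E' where E: "E = insert (M, m) E'" and "E' \<in> ?S" by blast
  then have E': "fst ` E' = A \<or> fst ` E' = A - {M}" "snd ` E' = B \<or> snd ` E' = B - {m}"
    and chain: "\<forall>e\<in>E'. \<forall>e'\<in>E'. fst e < fst e' \<longrightarrow> g (snd e) \<le> g (snd e')"
    by (auto simp: staircases_def)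
  from E' have sub: "fst ` E' \<subseteq> A" "snd ` E' \<subseteq> B" by auto
  have "fst ` E = A" "snd ` E = B" using E E' assms(2,4) by (auto simp: insert_absorb)
  \<comment> \<open>The corner never comes first, because \<open>M\<close> is maximal, and when it
    comes second it dominates, because \<open>g m\<close> is maximal.\<close>
  moreover have "g (snd e) \<le> g (snd e')" if "e \<in> E" "e' \<in> E" "fst e < fst e'" for e e'
  proof (cases "e = (M, m)")
    case True
    then have "fst e' \<le> M" using that(2) E sub(1) assms(2,3) by auto
    then show ?thesis using True that(3) by simp
  next
    case False
    then show ?thesis using that E chain sub(2) assms(5) by auto
  qed
  ultimately show "E \<in> staircases g A B" by (simp add: staircases_def)
qed

text \<open>The weight of all staircases between sets of sizes \<open>a\<close> and
  \<open>b\<close>, by the recursion \<open>staircases_rec\<close>: the factor \<open>x\<close> is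
  the deleted corner, the three summands are the possible remainders. If exactly one set is empty,
  there is no staircase.\<close>

fun staircase_poly :: "nat \<Rightarrow> nat \<Rightarrow> 'a::comm_ring_1 \<Rightarrow> 'a" where
  "staircase_poly 0 0 x = 1"
| "staircase_poly (Suc a) 0 x = 0"
| "staircase_poly 0 (Suc b) x = 0"
| "staircase_poly (Suc a) (Suc b) x =
     x * (staircase_poly a b x + staircase_poly a (Suc b) x + staircase_poly (Suc a) b x)"

text \<open>Both recursions agree after a shift by one in each index: a path with \<open>k\<close>
  steps matches a staircase with \<open>k + 1\<close> pairs, and the additional pair gives the
  factor \<open>x\<close>.\<close>

lemma staircase_poly_Suc_Suc: "staircase_poly (Suc a) (Suc b) x = x * delannoy a b x"
proof (induction "a + b" arbitrary: a b rule: less_induct)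
  case less
  have "staircase_poly a b x = (if a = 0 \<and> b = 0 then 1 else 0) +
      (if a > 0 \<and> b > 0 then x * delannoy (a - 1) (b - 1) x else 0)"
    using less[of "a - 1" "b - 1"] by (cases a; cases b) (simp_all del: staircase_poly.simps(4))
  moreover have "staircase_poly a (Suc b) x = (if a > 0 then x * delannoy (a - 1) b x else 0)"
    using less[of "a - 1" b] by (cases a) (simp_all del: staircase_poly.simps(4))
  moreover have "staircase_poly (Suc a) b x = (if b > 0 then x * delannoy a (b - 1) x else 0)"
    using less[of a "b - 1"] by (cases b) (simp_all del: staircase_poly.simps(4))
  ultimately show ?case
    by (subst delannoy_rec) (simp add: ac_simps)
qed

text \<open>Deleting the corner works for every injective \<open>g\<close>, so only the sizes matter
  and crossing and nesting give the same count.\<close>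

lemma sum_staircases:
  assumes "inj g" "finite A" "finite B"
  shows "(\<Sum>E\<in>staircases g A B. x ^ card E) = staircase_poly (card A) (card B) x"
  using assms(2,3)
proof (induction "card A" "card B" x arbitrary: A B rule: staircase_poly.induct)
  case (4 a b x)
  define M where "M = Max A"
  have A: "finite A" "A \<noteq> {}" and B: "finite B" "B \<noteq> {}" using 4 by auto
  have M: "M \<in> A" "\<And>a. a \<in> A \<Longrightarrow> a \<le> M" using A by (auto simp: M_def)
  have "Max (g ` B) \<in> g ` B" using B by simp
  \<comment> \<open>The corner is taken where \<open>g\<close> is largest; for an order-reversing
    \<open>g\<close> this is the smallest element of \<open>B\<close>.\<close>
  then obtain m where m: "m \<in> B" "g m = Max (g ` B)" by force
  then have m': "g b \<le> g m" if "b \<in> B" for b using that B by auto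
  let ?S1 = "staircases g (A - {M}) (B - {m})" and ?S2 = "staircases g (A - {M}) B"
    and ?S3 = "staircases g A (B - {m})"
  have fin: "finite ?S1" "finite ?S2" "finite ?S3" using A B by (auto intro!: finite_staircases)
  have notin: "(M, m) \<notin> E \<and> finite E" if "E \<in> ?S1 \<union> ?S2 \<union> ?S3" for E
    using that A B by (auto dest!: staircases_subset elim!: finite_subset)
  \<comment> \<open>The three families differ in domain or range.\<close>
  have disj: "?S1 \<inter> ?S2 = {}" "(?S1 \<union> ?S2) \<inter> ?S3 = {}"
    using M(1) m(1) by (auto simp: staircases_def)
  have inj: "inj_on (insert (M, m)) (?S1 \<union> ?S2 \<union> ?S3)"
    using notin by (intro inj_onI) (metis insert_ident)
  have c: "card (A - {M}) = a" "card (B - {m}) = b" using 4 M m A B by auto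
  have "(\<Sum>E\<in>staircases g A B. x ^ card E) = (\<Sum>E\<in>?S1 \<union> ?S2 \<union> ?S3. x ^ card (insert (M, m) E))"
    using inj by (simp add: staircases_rec[OF assms(1) M m(1) m'] sum.reindex)
  also have "\<dots> = (\<Sum>E\<in>?S1 \<union> ?S2 \<union> ?S3. x * x ^ card E)"
    using notin by (intro sum.cong) auto
  also have "\<dots> = x * ((\<Sum>E\<in>?S1. x ^ card E) + (\<Sum>E\<in>?S2. x ^ card E) + (\<Sum>E\<in>?S3. x ^ card E))"
    using fin disj by (simp add: sum.union_disjoint sum_distrib_left distrib_left)
  also have "\<dots> = staircase_poly (card A) (card B) x"
    using 4(1)[of "A - {M}" "B - {m}"] 4(2)[of "A - {M}" B] 4(3)[of A "B - {m}"] c A(1) B(1)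
    unfolding 4(4,5)[symmetric] by simp
  finally show ?case .
next
  case (1 x)
  then have "A = {}" "B = {}" by auto
  then show ?case by (simp add: staircases_empty)
next
  case (2 a x)
  then have "A \<noteq> {}" "B = {}" by auto
  then show ?case using 2 by (simp add: staircases_empty flip: 2(1))
next
  case (3 b x)
  then have "A = {}" "B \<noteq> {}" by auto
  then show ?case using 3 by (simp add: staircases_empty flip: 3(2))
qed

subsection \<open>Tail and head sets\<close>

text \<open>Take \<open>p = Max X\<close> and \<open>q = Min Y\<close>. A point of \<open>Y\<close>
  is at least \<open>p\<close>, so every smaller point lies in \<open>X\<close>; likewise every
  point above \<open>q\<close> lies in \<open>Y\<close>. Since no point is left uncovered,
  \<open>q\<close> is \<open>p\<close> or \<open>p + 1\<close>.\<close>

lemma split_interval: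
  fixes X Y :: "nat set"
  assumes "X \<noteq> {}" "Y \<noteq> {}" "X \<union> Y = {1..N}" "\<And>i j. i \<in> X \<Longrightarrow> j \<in> Y \<Longrightarrow> i \<le> j"
  obtains p where "1 \<le> p" "p \<le> N" "X = {1..p}" "Y = {p..N} \<or> Y = {p+1..N}"
proof -
  have sub: "X \<subseteq> {1..N}" "Y \<subseteq> {1..N}"
    using assms(3) by blast+
  then have fin: "finite X" "finite Y"
    by (auto intro: finite_subset)
  define p q where "p = Max X" and "q = Min Y"
  have p: "p \<in> X" "\<And>i. i \<in> X \<Longrightarrow> i \<le> p" and q: "q \<in> Y" "\<And>j. j \<in> Y \<Longrightarrow> q \<le> j"
    using fin assms(1,2) by (auto simp: p_def q_def)
  have pq: "p \<le> q" "1 \<le> p" "q \<le> N" using assms(4) p q sub by auto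
  have X: "X = {1..p}"
  proof
    show "{1..p} \<subseteq> X"
    proof
      fix j assume j: "j \<in> {1..p}"
      then have "j \<in> X \<union> Y" using pq assms(3) by auto
      then show "j \<in> X" using assms(4)[OF p(1), of j] j p(1) by force
    qed
  qed (use p sub in auto)
  have Y: "Y = {q..N}"
  proof
    show "{q..N} \<subseteq> Y"
    proof
      fix j assume j: "j \<in> {q..N}"
      then have "j \<in> X \<union> Y" using pq assms(3) by auto
      then show "j \<in> Y" using assms(4)[OF _ q(1), of j] j q(1) by force
    qed
  qed (use q sub in auto)
  have "q \<le> p + 1"
  proof (rule ccontr)
    assume "\<not> q \<le> p + 1"
    then have "p + 1 \<in> {1..N}" "p + 1 \<notin> X \<union> Y" using pq X Y by auto
    then show False using assms(3) by simp
  qed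
  then have "q = p \<or> q = p + 1" using pq by linarith
  with X Y pq show thesis by (intro that[of p]) auto
qed

text \<open>Strict inequality rules out the shared point, and \<open>Y\<close> being nonempty gives
  \<open>p \<le> n\<close>.\<close>

lemma split_interval_strict:
  fixes X Y :: "nat set"
  assumes "X \<noteq> {}" "Y \<noteq> {}" "X \<union> Y = {1..n+1}" "\<forall>i\<in>X. \<forall>j\<in>Y. i < j"
  obtains p where "p \<in> {1..n}" "X = {1..p}" "Y = {p+1..n+1}"
proof -
  have "i \<le> j" if "i \<in> X" "j \<in> Y" for i j
    using assms(4) that by (auto intro: less_imp_le)
  then obtain p where p: "1 \<le> p" "p \<le> n + 1" "X = {1..p}" "Y = {p..n+1} \<or> Y = {p+1..n+1}"
    by (rule split_interval[OF assms(1-3)])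
  have "p \<in> X" using p by simp
  then have "p \<notin> Y" using assms(4) by blast
  then have Y: "Y = {p+1..n+1}" using p by auto
  then have "p \<le> n" using assms(2) by auto
  with p(1,3) Y show thesis by (intro that[of p]) auto
qed

section \<open>Ordered bipartitions and their number\<close>

definition bipartitions :: "'b set \<Rightarrow> nat \<Rightarrow> nat \<Rightarrow> ('b set \<times> 'b set) set" where
  "bipartitions S i j = {(P, Q). P \<union> Q = S \<and> P \<inter> Q = {} \<and> card P = i \<and> card Q = j}"

lemma finite_bipartitions: "finite S \<Longrightarrow> finite (bipartitions S i j)"
  by (rule finite_subset[of _ "Pow S \<times> Pow S"]) (auto simp: bipartitions_def)

lemma bipartitions_subset: "(P, Q) \<in> bipartitions S i j \<Longrightarrow> P \<subseteq> S \<and> Q \<subseteq> S"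
  by (auto simp: bipartitions_def)

text \<open>\<open>P\<close> determines \<open>Q\<close> as its complement. The value 0 for
  incompatible sizes later singles out the possible numbers of vertices.\<close>

lemma card_bipartitions:
  assumes "finite S"
  shows "card (bipartitions S i j) = (if card S = i + j then (i + j) choose i else 0)"
proof (cases "card S = i + j")
  case True
  have "bipartitions S i j = (\<lambda>P. (P, S - P)) ` {P. P \<subseteq> S \<and> card P = i}" (is "_ = ?f ` ?P")
  proof (intro equalityI subsetI)
    fix x assume "x \<in> bipartitions S i j"
    then show "x \<in> ?f ` ?P" by (auto simp: bipartitions_def)
  next
    fix x assume "x \<in> ?f ` ?P"
    then show "x \<in> bipartitions S i j"
      using assms True by (auto simp: bipartitions_def card_Diff_subset finite_subset)
  qed
  moreover have "inj_on ?f ?P" by (auto intro: inj_onI)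
  ultimately show ?thesis using n_subsets[OF assms, of i] True by (simp add: card_image)
next
  case False
  have "bipartitions S i j = {}"
  proof (rule ccontr)
    assume "bipartitions S i j \<noteq> {}"
    then obtain P Q where "P \<union> Q = S" "P \<inter> Q = {}" "card P = i" "card Q = j"
      by (auto simp: bipartitions_def)
    then show False using False assms card_Un_disjoint[of P Q] by auto
  qed
  then show ?thesis using False by simp
qed

text \<open>A quadruple consists of the forward tails, forward heads, backward tails and backward
  heads of a face.\<close>

definition mixed_configs :: "nat \<Rightarrow> (nat set \<times> nat set \<times> nat set \<times> nat set) set" where
  "mixed_configs N = {(A, B, A', B').
     A \<noteq> {} \<and> B \<noteq> {} \<and> A' \<noteq> {} \<and> B' \<noteq> {} \<and> (A \<union> A') \<inter> (B \<union> B') = {} \<and>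
     (\<forall>i\<in>A \<union> B'. \<forall>j\<in>B \<union> A'. i \<le> j) \<and> A \<union> B \<union> A' \<union> B' = {1..N}}"

lemma mixed_configs_subset:
  "mixed_configs N \<subseteq> Pow {1..N} \<times> Pow {1..N} \<times> Pow {1..N} \<times> Pow {1..N}"
  by (auto simp: mixed_configs_def)

lemma finite_mixed_configs: "finite (mixed_configs N)"
  by (rule finite_subset[OF mixed_configs_subset]) simp

text \<open>The four sets are nonempty; their sizes minus one are the indices of the Delannoy
  polynomials.\<close>

definition sized_configs ::
    "nat \<Rightarrow> nat \<Rightarrow> nat \<Rightarrow> nat \<Rightarrow> nat \<Rightarrow> (nat set \<times> nat set \<times> nat set \<times> nat set) set" where
  "sized_configs N a b c d = {(A, B, A', B') \<in> mixed_configs N.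
     card A = a + 1 \<and> card B = b + 1 \<and> card A' = c + 1 \<and> card B' = d + 1}"

text \<open>By \<open>split_interval\<close> the left set \<open>A \<union> B'\<close> and the right
  set \<open>B \<union> A'\<close> share at most one point \<open>p\<close>. As no vertex is both a
  tail and a head, a shared \<open>p\<close> is a tail in both directions or a head in both.\<close>

lemma mixed_configs_cases:
  assumes "(A, B, A', B') \<in> mixed_configs N"
  obtains (disjoint) p where "A \<union> B' = {1..p}" "B \<union> A' = {p+1..N}" "A \<inter> B' = {}" "B \<inter> A' = {}"
  | (common_tail) p where "1 \<le> p" "p \<le> N" "A \<union> B' = {1..p}" "B \<union> A' = {p..N}"
      "p \<in> A" "p \<in> A'" "A \<inter> B' = {}" "B \<inter> A' = {}"
  | (common_head) p where "1 \<le> p" "p \<le> N" "A \<union> B' = {1..p}" "B \<union> A' = {p..N}"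
      "p \<in> B" "p \<in> B'" "A \<inter> B' = {}" "B \<inter> A' = {}"
proof -
  have disj: "A \<inter> B = {}" "A' \<inter> B' = {}" "A \<inter> B' = {}" "B \<inter> A' = {}"
    and "A \<union> B' \<noteq> {}" "B \<union> A' \<noteq> {}" "(A \<union> B') \<union> (B \<union> A') = {1..N}"
    and "\<And>i j. i \<in> A \<union> B' \<Longrightarrow> j \<in> B \<union> A' \<Longrightarrow> i \<le> j"
    using assms by (auto simp: mixed_configs_def)
  then obtain p where p: "1 \<le> p" "p \<le> N" "A \<union> B' = {1..p}"
    "B \<union> A' = {p..N} \<or> B \<union> A' = {p+1..N}"
    by (elim split_interval[of "A \<union> B'" "B \<union> A'" N])
  show thesis
  proof (cases "B \<union> A' = {p+1..N}")
    case True
    then show ?thesis using disjoint p disj by blast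
  next
    case False
    then have eq: "B \<union> A' = {p..N}" using p by blast
    have "p \<in> A \<union> B'" "p \<in> B \<union> A'" using p(1-3) eq by auto
    then have "p \<in> A \<and> p \<in> A' \<or> p \<in> B \<and> p \<in> B'" using disj by blast
    then show ?thesis using common_tail common_head p(1-3) eq disj by blast
  qed
qed

text \<open>\<open>L\<close> is the size of the left set, hence its last vertex. The families are:
  no shared vertex, \<open>L\<close> a common head, \<open>L\<close> a common tail. In the last two
  \<open>L\<close> is taken out of the two sets that contain it, and these are listed first so that
  the binomial coefficients come out as in \<open>mixed_factor\<close>.\<close>

lemma sized_configs_eq:
  fixes a b c d N :: nat
  defines "L \<equiv> a + d + 2"
  shows "sized_configs N a b c d =
    (\<lambda>((A, B'), (B, A')). (A, B, A', B')) `
      (bipartitions {1..L} (a+1) (d+1) \<times> bipartitions {L+1..N} (b+1) (c+1)) \<union>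
    (\<lambda>((B', A), (B, A')). (A, insert L B, A', insert L B')) `
      (bipartitions {1..<L} d (a+1) \<times> bipartitions {L+1..N} b (c+1)) \<union>
    (\<lambda>((A, B'), (A', B)). (insert L A, B, insert L A', B')) `
      (bipartitions {1..<L} a (d+1) \<times> bipartitions {L+1..N} c (b+1))"
    (is "_ = ?f1 ` ?S1 \<union> ?f2 ` ?S2 \<union> ?f3 ` ?S3")
proof (intro equalityI subsetI)
  fix q assume q: "q \<in> sized_configs N a b c d"
  obtain A B A' B' where [simp]: "q = (A, B, A', B')" by (cases q)
  have mix: "(A, B, A', B') \<in> mixed_configs N"
    and card: "card A = a + 1" "card B = b + 1" "card A' = c + 1" "card B' = d + 1"
    using q by (auto simp: sized_configs_def)
  have fin: "finite A" "finite B" "finite A'" "finite B'"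
    using card by (auto intro: card_ge_0_finite)
  \<comment> \<open>The left set is a disjoint union of sets of sizes \<open>a + 1\<close> and
    \<open>d + 1\<close>.\<close>
  have L: "L = p" if "A \<union> B' = {1..p}" "A \<inter> B' = {}" for p
    using card_Un_disjoint[of A B'] fin that card by (simp add: L_def)
  from mix show "q \<in> ?f1 ` ?S1 \<union> ?f2 ` ?S2 \<union> ?f3 ` ?S3"
  proof (cases rule: mixed_configs_cases)
    case (disjoint p)
    have "p = L" using L disjoint by blast
    then have "((A, B'), (B, A')) \<in> ?S1" using disjoint card by (auto simp: bipartitions_def)
    then have "?f1 ((A, B'), (B, A')) \<in> ?f1 ` ?S1" by (rule imageI)
    then show ?thesis by simp
  next
    case (common_head p)
    have p: "p = L" using L common_head by blast
    have "p \<notin> A" "p \<notin> A'" using common_head by auto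
    moreover have "{1..<p} = {1..p} - {p}" "{p+1..N} = {p..N} - {p}" by auto
    ultimately have "((B' - {p}, A), (B - {p}, A')) \<in> ?S2"
      using common_head fin card unfolding p by (auto simp: bipartitions_def)
    then have "?f2 ((B' - {p}, A), (B - {p}, A')) \<in> ?f2 ` ?S2" by (rule imageI)
    moreover have "?f2 ((B' - {p}, A), (B - {p}, A')) = q"
      using common_head p by (auto simp: insert_absorb)
    ultimately show ?thesis by simp
  next
    case (common_tail p)
    have p: "p = L" using L common_tail by blast
    have "p \<notin> B" "p \<notin> B'" using common_tail by auto
    moreover have "{1..<p} = {1..p} - {p}" "{p+1..N} = {p..N} - {p}" by auto
    ultimately have "((A - {p}, B'), (A' - {p}, B)) \<in> ?S3"
      using common_tail fin card unfolding p by (auto simp: bipartitions_def)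
    then have "?f3 ((A - {p}, B'), (A' - {p}, B)) \<in> ?f3 ` ?S3" by (rule imageI)
    moreover have "?f3 ((A - {p}, B'), (A' - {p}, B)) = q"
      using common_tail p by (auto simp: insert_absorb)
    ultimately show ?thesis by simp
  qed
next
  \<comment> \<open>Membership is reduced to the left block \<open>X\<close> and the right block
    \<open>Y\<close>, which each family provides explicitly.\<close>
  have intro: "(A, B, A', B') \<in> sized_configs N a b c d"
    if "A \<union> B' = X" "B \<union> A' = Y" "A \<inter> B' = {}" "B \<inter> A' = {}" "A \<inter> B = {}" "B' \<inter> A' = {}"
      "X \<union> Y = {1..N}" "\<And>i j. i \<in> X \<Longrightarrow> j \<in> Y \<Longrightarrow> i \<le> j"
      "card A = a + 1" "card B = b + 1" "card A' = c + 1" "card B' = d + 1" for A B A' B' X Y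
  proof -
    have "A \<noteq> {}" "B \<noteq> {}" "A' \<noteq> {}" "B' \<noteq> {}" using that(9-12) by auto
    moreover have "(A \<union> A') \<inter> (B \<union> B') = {}" using that(3-6) by blast
    moreover have "A \<union> B \<union> A' \<union> B' = {1..N}" using that(1,2,7) by blast
    moreover have "\<forall>i\<in>A \<union> B'. \<forall>j\<in>B \<union> A'. i \<le> j" using that(1,2,8) by simp
    ultimately show ?thesis using that(9-12) by (simp add: sized_configs_def mixed_configs_def)
  qed
  have separate: "P \<inter> Q = {}" if "P \<subseteq> {..L}" "Q \<subseteq> {L<..}" for P Q
  proof -
    have "P \<inter> Q \<subseteq> {..L} \<inter> {L<..}" using that by blast
    also have "\<dots> = {}" by auto
    finally show ?thesis by simp
  qed
  fix q assume "q \<in> ?f1 ` ?S1 \<union> ?f2 ` ?S2 \<union> ?f3 ` ?S3"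
  then consider (disjoint) A B' B A' where "q = (A, B, A', B')" "((A, B'), (B, A')) \<in> ?S1"
    | (common_head) A B' B A' where "q = (A, insert L B, A', insert L B')" "((B', A), (B, A')) \<in> ?S2"
    | (common_tail) A B' B A' where "q = (insert L A, B, insert L A', B')" "((A, B'), (A', B)) \<in> ?S3"
    by fast
  then show "q \<in> sized_configs N a b c d"
  proof cases
    case disjoint
    then have *: "A \<union> B' = {1..L}" "B \<union> A' = {L+1..N}" "A \<inter> B' = {}" "B \<inter> A' = {}"
      "card A = a + 1" "card B = b + 1" "card A' = c + 1" "card B' = d + 1"
      by (auto simp: bipartitions_def)
    then have "B \<noteq> {}" by auto
    \<comment> \<open>Without this bound \<open>{1..L}\<close> could reach beyond
      \<open>{1..N}\<close>.\<close>
    then have "L + 1 \<le> N" using *(2) by auto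
    moreover have "A \<subseteq> {1..L}" "B' \<subseteq> {1..L}" "B \<subseteq> {L+1..N}" "A' \<subseteq> {L+1..N}"
      using *(1,2) by blast+
    then have "A \<inter> B = {}" "B' \<inter> A' = {}" by (auto intro!: separate elim: order_trans)
    ultimately show ?thesis
      unfolding disjoint(1) using * by (intro intro[of _ _ "{1..L}" _ _ "{L+1..N}"]) auto
  next
    case common_head
    then have *: "A \<union> B' = {1..<L}" "B \<union> A' = {L+1..N}" "A \<inter> B' = {}" "B \<inter> A' = {}"
      "card A = a + 1" "card B = b" "card A' = c + 1" "card B' = d"
      by (auto simp: bipartitions_def)
    then have "A' \<noteq> {}" by auto
    then have N: "L + 1 \<le> N" using *(2) by auto
    have sub: "A \<subseteq> {1..<L}" "B' \<subseteq> {1..<L}" "B \<subseteq> {L+1..N}" "A' \<subseteq> {L+1..N}"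
      using *(1,2) by blast+
    then have fin: "finite A" "finite B" "finite A'" "finite B'" by (auto intro: finite_subset)
    have "L \<notin> A" "L \<notin> B" "L \<notin> A'" "L \<notin> B'" using sub by auto
    moreover have "A \<inter> B = {}" "B' \<inter> A' = {}"
      using sub by (auto intro!: separate elim: order_trans)
    \<comment> \<open>The common vertex goes back into both blocks, which then meet only in
      \<open>L\<close>.\<close>
    moreover have "{1..L} = insert L {1..<L}" "{L..N} = insert L {L+1..N}"
      using N by (auto simp: L_def)
    ultimately show ?thesis
      unfolding common_head(1) using * fin N by (intro intro[of _ _ "{1..L}" _ _ "{L..N}"]) auto
  next
    case common_tail
    then have *: "A \<union> B' = {1..<L}" "B \<union> A' = {L+1..N}" "A \<inter> B' = {}" "B \<inter> A' = {}"
      "card A = a" "card B = b + 1" "card A' = c" "card B' = d + 1"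
      by (auto simp: bipartitions_def)
    then have "B \<noteq> {}" by auto
    then have N: "L + 1 \<le> N" using *(2) by auto
    have sub: "A \<subseteq> {1..<L}" "B' \<subseteq> {1..<L}" "B \<subseteq> {L+1..N}" "A' \<subseteq> {L+1..N}"
      using *(1,2) by blast+
    then have fin: "finite A" "finite B" "finite A'" "finite B'" by (auto intro: finite_subset)
    have "L \<notin> A" "L \<notin> B" "L \<notin> A'" "L \<notin> B'" using sub by auto
    moreover have "A \<inter> B = {}" "B' \<inter> A' = {}"
      using sub by (auto intro!: separate elim: order_trans)
    moreover have "{1..L} = insert L {1..<L}" "{L..N} = insert L {L+1..N}"
      using N by (auto simp: L_def)
    ultimately show ?thesis
      unfolding common_tail(1) using * fin N by (intro intro[of _ _ "{1..L}" _ _ "{L..N}"]) auto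
  qed
qed

text \<open>The three families are disjoint: \<open>L\<close> lies in \<open>B\<close> exactly in
  the second and in \<open>A'\<close> exactly in the third. Their sizes are products of two binomial
  coefficients, one for each side of the split.\<close>

lemma card_sized_configs:
  "card (sized_configs N a b c d) =
    (if N = a + b + c + d + 4 then ((a + d + 2) choose (a + 1)) * ((c + b + 2) choose (b + 1))
     else if N = a + b + c + d + 3
     then ((a + d + 1) choose d) * ((c + b + 1) choose b) + ((a + d + 1) choose a) * ((c + b + 1) choose c)
     else 0)"
proof -
  define L where "L = a + d + 2"
  define S1 where "S1 = bipartitions {1..L} (a+1) (d+1) \<times> bipartitions {L+1..N} (b+1) (c+1)"
  define S2 where "S2 = bipartitions {1..<L} d (a+1) \<times> bipartitions {L+1..N} b (c+1)"
  define S3 where "S3 = bipartitions {1..<L} a (d+1) \<times> bipartitions {L+1..N} c (b+1)"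
  let ?f1 = "\<lambda>((A, B'), (B, A')). (A, B, A', B')"
  let ?f2 = "\<lambda>((B', A), (B, A')). (A, insert L B, A', insert L B')"
  let ?f3 = "\<lambda>((A, B'), (A', B)). (insert L A, B, insert L A', B')"
  have fin: "finite S1" "finite S2" "finite S3"
    by (auto simp: S1_def S2_def S3_def intro!: finite_bipartitions)
  have L: "L \<notin> {1..<L}" "L \<notin> {L+1..N}" by auto
  have S1: "L \<notin> B \<and> L \<notin> A'" if "((A, B'), (B, A')) \<in> S1" for A B A' B'
    using that L unfolding S1_def by (blast dest: bipartitions_subset)
  have S2: "L \<notin> A \<and> L \<notin> B \<and> L \<notin> A' \<and> L \<notin> B'" if "((B', A), (B, A')) \<in> S2" for A B A' B'
    using that L unfolding S2_def by (blast dest: bipartitions_subset)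
  have S3: "L \<notin> A \<and> L \<notin> B \<and> L \<notin> A' \<and> L \<notin> B'" if "((A, B'), (A', B)) \<in> S3" for A B A' B'
    using that L unfolding S3_def by (blast dest: bipartitions_subset)
  have inj: "inj_on ?f1 S1" "inj_on ?f2 S2" "inj_on ?f3 S3"
    by (auto intro!: inj_onI dest!: S2 S3 simp: insert_ident)
  have disj: "?f1 ` S1 \<inter> ?f2 ` S2 = {}" "(?f1 ` S1 \<union> ?f2 ` S2) \<inter> ?f3 ` S3 = {}"
    by (auto dest!: S1 S2 S3)
  have "card (sized_configs N a b c d) = card S1 + card S2 + card S3"
    unfolding sized_configs_eq L_def[symmetric] S1_def[symmetric] S2_def[symmetric] S3_def[symmetric]
    using fin disj inj by (simp add: card_Un_disjoint card_image)
  \<comment> \<open>The block \<open>{L+1..N}\<close> must have \<open>b + c + 2\<close> elements in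
    the first family and \<open>b + c + 1\<close> in the others, so \<open>N\<close> is
    \<open>a + b + c + d + 4\<close> or, with a shared vertex, one less.\<close>
  also have "\<dots> = (if N = a + b + c + d + 4 then ((a + d + 2) choose (a + 1)) * ((c + b + 2) choose (b + 1))
     else if N = a + b + c + d + 3
     then ((a + d + 1) choose d) * ((c + b + 1) choose b) + ((a + d + 1) choose a) * ((c + b + 1) choose c)
     else 0)"
    by (auto simp: S1_def S2_def S3_def card_cartesian_product card_bipartitions L_def ac_simps)
  finally show ?thesis .
qed

text \<open>The right side is the form in which the edge conditions arise. Within one direction,
  weak order together with disjointness of tails and heads is strict order.\<close>

lemma mixed_configs_iff:
  assumes "A \<noteq> {}" "B \<noteq> {}" "A' \<noteq> {}" "B' \<noteq> {}"
  shows "(A, B, A', B') \<in> mixed_configs N \<longleftrightarrow>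
    (\<forall>i\<in>A. \<forall>j\<in>B. i < j) \<and> (\<forall>i\<in>B'. \<forall>j\<in>A'. i < j) \<and> A \<inter> B' = {} \<and> B \<inter> A' = {} \<and>
    (\<forall>i\<in>A \<union> B'. \<forall>j\<in>B \<union> A'. i \<le> j) \<and> A \<union> B \<union> A' \<union> B' = {1..N}"
    (is "?l \<longleftrightarrow> ?r")
proof
  assume ?l
  then have d: "(A \<union> A') \<inter> (B \<union> B') = {}" and le: "\<forall>i\<in>A \<union> B'. \<forall>j\<in>B \<union> A'. i \<le> j"
    and un: "A \<union> B \<union> A' \<union> B' = {1..N}"
    by (simp_all add: mixed_configs_def)
  from d have *: "A \<inter> B = {}" "B' \<inter> A' = {}" "A \<inter> B' = {}" "B \<inter> A' = {}"
    by blast+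
  have "i < j" if "i \<in> A \<and> j \<in> B \<or> i \<in> B' \<and> j \<in> A'" for i j
  proof -
    have "i \<noteq> j" "i \<le> j" using that *(1,2) le by blast+
    then show ?thesis by simp
  qed
  with * le un show ?r by simp
next
  assume r: ?r
  have irrefl: "P \<inter> Q = {}" if "\<forall>i\<in>P. \<forall>j\<in>Q. i < j" for P Q :: "nat set"
  proof (rule equals0I)
    fix k assume "k \<in> P \<inter> Q"
    then have "k < k" using that by blast
    then show False by simp
  qed
  from r have "A \<inter> B = {}" "B' \<inter> A' = {}" "A \<inter> B' = {}" "B \<inter> A' = {}"
    by (simp_all add: irrefl)
  then have "(A \<union> A') \<inter> (B \<union> B') = {}"
    by (simp add: Int_Un_distrib Int_Un_distrib2 Int_commute)
  with r assms show ?l by (simp add: mixed_configs_def)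
qed

subsection \<open>Saturated faces\<close>

context nest_cross_rules
begin

section \<open>Forward and backward parts of a face\<close>

abbreviation forward_order :: "nat \<Rightarrow> int" where
  "forward_order \<equiv> orientation (R [Tail, Tail, Head, Head])"

abbreviation backward_order :: "nat \<Rightarrow> int" where
  "backward_order \<equiv> orientation (R [Head, Head, Tail, Tail])"

text \<open>Symmetric form of the criterion, without a choice of the smaller tail. For a common tail
  the two order clauses are void and the rest follows from the arrows being forward.\<close>

lemma edge_forward_forward:
  assumes "forward a" "forward b" "a \<noteq> b"
  shows "edge R a b \<longleftrightarrow> fst b < snd a \<and> fst a < snd b \<and>
    (fst a < fst b \<longrightarrow> forward_order (snd a) \<le> forward_order (snd b)) \<and>
    (fst b < fst a \<longrightarrow> forward_order (snd b) \<le> forward_order (snd a))"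
proof -
  obtain t h t' h' where [simp]: "a = (t, h)" "b = (t', h')" by (metis surj_pair)
  have "t < h" "t' < h'" using assms by (auto simp: forward_def)
  then show ?thesis
    using assms(3) edge_forward_forward_aux[of t h t' h'] edge_forward_forward_aux[of t' h' t h]
      edge_sym[of R a b]
    by (cases t t' rule: linorder_cases) (auto simp: edge_def[of R "(t', h)"])
qed

lemma edge_backward_backward:
  assumes "backward a" "backward b" "a \<noteq> b"
  shows "edge R a b \<longleftrightarrow> snd b < fst a \<and> snd a < fst b \<and>
    (fst a < fst b \<longrightarrow> backward_order (snd a) \<le> backward_order (snd b)) \<and>
    (fst b < fst a \<longrightarrow> backward_order (snd b) \<le> backward_order (snd a))"
proof -
  obtain t h t' h' where [simp]: "a = (t, h)" "b = (t', h')" by (metis surj_pair)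
  have "h < t" "h' < t'" using assms by (auto simp: backward_def)
  then show ?thesis
    using assms(3) edge_backward_backward_aux[of h t h' t'] edge_backward_backward_aux[of h' t' h t]
      edge_sym[of R a b]
    by (cases t t' rule: linorder_cases) (auto simp: edge_def[of R "(t', h)"])
qed

text \<open>The flag condition of \<open>Delta\<close>, detached from \<open>n\<close> so that it
  can be applied to the forward and backward parts separately.\<close>

definition pairwise_edges :: "arrow set \<Rightarrow> bool" where
  "pairwise_edges \<sigma> \<longleftrightarrow> (\<forall>a\<in>\<sigma>. \<forall>b\<in>\<sigma>. a \<noteq> b \<longrightarrow> edge R a b)"

text \<open>The criterion for two arrows separates into a condition on the tail and head sets alone
  and the staircase condition. In the former, comparing an arrow with itself expresses that it is
  forward.\<close>

lemma pairwise_edges_forward: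
  assumes "\<And>a. a \<in> F \<Longrightarrow> forward a"
  shows "pairwise_edges F \<longleftrightarrow>
    (\<forall>i\<in>fst ` F. \<forall>j\<in>snd ` F. i < j) \<and> F \<in> staircases forward_order (fst ` F) (snd ` F)"
    (is "_ \<longleftrightarrow> ?lt \<and> ?st")
proof
  assume *: "pairwise_edges F"
  have "fst a < snd b" if "a \<in> F" "b \<in> F" for a b
    using * assms[OF that(1)] assms[OF that(2)] that edge_forward_forward[of a b]
    by (cases "a = b") (auto simp: pairwise_edges_def forward_def)
  moreover have "forward_order (snd a) \<le> forward_order (snd b)"
    if "a \<in> F" "b \<in> F" "fst a < fst b" for a b
  proof -
    have "a \<noteq> b" using that(3) by auto
    then show ?thesis
      using * assms[OF that(1)] assms[OF that(2)] that edge_forward_forward[of a b]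
      by (simp add: pairwise_edges_def)
  qed
  ultimately show "?lt \<and> ?st" by (simp add: staircases_def)
next
  assume "?lt \<and> ?st"
  then show "pairwise_edges F"
    using assms by (simp add: pairwise_edges_def staircases_def edge_forward_forward)
qed

lemma pairwise_edges_backward:
  assumes "\<And>a. a \<in> G \<Longrightarrow> backward a"
  shows "pairwise_edges G \<longleftrightarrow>
    (\<forall>i\<in>snd ` G. \<forall>j\<in>fst ` G. i < j) \<and> G \<in> staircases backward_order (fst ` G) (snd ` G)"
    (is "_ \<longleftrightarrow> ?lt \<and> ?st")
proof
  assume *: "pairwise_edges G"
  have "snd a < fst b" if "a \<in> G" "b \<in> G" for a b
    using * assms[OF that(1)] assms[OF that(2)] that edge_backward_backward[of a b]
    by (cases "a = b") (auto simp: pairwise_edges_def backward_def)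
  moreover have "backward_order (snd a) \<le> backward_order (snd b)"
    if "a \<in> G" "b \<in> G" "fst a < fst b" for a b
  proof -
    have "a \<noteq> b" using that(3) by auto
    then show ?thesis
      using * assms[OF that(1)] assms[OF that(2)] that edge_backward_backward[of a b]
      by (simp add: pairwise_edges_def)
  qed
  ultimately show "?lt \<and> ?st" by (simp add: staircases_def)
next
  assume "?lt \<and> ?st"
  then show "pairwise_edges G"
    using assms by (simp add: pairwise_edges_def staircases_def edge_backward_backward)
qed

lemma forward_not_backward: "forward a \<Longrightarrow> \<not> backward a"
  by (simp add: forward_def backward_def)

text \<open>The mixed edges depend only on the four endpoint sets: a common tail or a common head is
  the equality case of one of the two overlap inequalities, and then the other holds strictly. This
  is why the two staircases can be chosen independently.\<close>

lemma forward_backward_edges: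
  assumes "F \<noteq> {}" "G \<noteq> {}" "\<And>a. a \<in> F \<Longrightarrow> forward a" "\<And>a. a \<in> G \<Longrightarrow> backward a"
    and lt: "\<forall>i\<in>fst ` F. \<forall>j\<in>snd ` F. i < j" "\<forall>i\<in>snd ` G. \<forall>j\<in>fst ` G. i < j"
  shows "(\<forall>a\<in>F. \<forall>b\<in>G. edge R a b) \<longleftrightarrow>
    fst ` F \<inter> snd ` G = {} \<and> snd ` F \<inter> fst ` G = {} \<and>
    (\<forall>i\<in>fst ` F \<union> snd ` G. \<forall>j\<in>snd ` F \<union> fst ` G. i \<le> j)"
    (is "?l \<longleftrightarrow> ?r")
proof -
  have edge: "edge R a b \<longleftrightarrow> fst a = fst b \<or> snd a = snd b \<or>
      fst a \<noteq> snd b \<and> snd a \<noteq> fst b \<and> fst a < fst b \<and> snd b < snd a"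
    if "a \<in> F" "b \<in> G" for a b
    using edge_forward_backward[of "fst a" "snd a" "snd b" "fst b"] assms(3)[OF that(1)]
      assms(4)[OF that(2)] by (simp add: forward_def backward_def)
  have ltF: "fst a < snd a'" if "a \<in> F" "a' \<in> F" for a a' using lt that by simp
  have ltG: "snd b < fst b'" if "b \<in> G" "b' \<in> G" for b b' using lt that by simp
  show ?thesis
  proof
    assume ?l
    then have l: "fst a = fst b \<or> snd a = snd b \<or>
        fst a \<noteq> snd b \<and> snd a \<noteq> fst b \<and> fst a < fst b \<and> snd b < snd a"
      if "a \<in> F" "b \<in> G" for a b using edge that by blast
    have "fst a \<noteq> snd b \<and> snd a \<noteq> fst b" if "a \<in> F" "b \<in> G" for a b
      using l[OF that] ltF[OF that(1,1)] ltG[OF that(2,2)] by auto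
    moreover have "fst a \<le> fst b \<and> snd b \<le> snd a" if "a \<in> F" "b \<in> G" for a b
      using l[OF that] ltF[OF that(1,1)] ltG[OF that(2,2)] by auto
    ultimately show ?r
      using ltF ltG by (auto simp: disjoint_iff less_imp_le)
  next
    assume ?r
    show ?l
    proof (intro ballI)
      fix a b assume ab: "a \<in> F" "b \<in> G"
      with \<open>?r\<close> have "fst a \<noteq> snd b \<and> snd a \<noteq> fst b \<and> fst a \<le> fst b \<and> snd b \<le> snd a"
        by (auto simp: disjoint_iff)
      \<comment> \<open>Equality in one of the weak inequalities is a common tail or head; otherwise
        both are strict and the intervals overlap.\<close>
      then show "edge R a b" using edge[OF ab] by auto
    qed
  qed
qed

section \<open>Saturated faces: mixed, all forward, all backward\<close>

lemma endpoints_Union: "(\<Union>a\<in>\<sigma>. endpoints a) = fst ` \<sigma> \<union> snd ` \<sigma>"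
  by (auto simp: endpoints_def)

text \<open>Saturation already confines all endpoints to \<open>{1..n+1}\<close>, so membership in
  \<open>arrows n\<close> is automatic.\<close>

lemma saturated_faces_iff:
  assumes "n \<ge> 1" "\<And>a. a \<in> \<sigma> \<Longrightarrow> forward a \<or> backward a"
  shows "\<sigma> \<in> saturated_faces R n \<longleftrightarrow> pairwise_edges \<sigma> \<and> fst ` \<sigma> \<union> snd ` \<sigma> = {1..n+1}"
proof -
  have "\<sigma> \<subseteq> arrows n" if "fst ` \<sigma> \<union> snd ` \<sigma> = {1..n+1}"
  proof
    fix a assume a: "a \<in> \<sigma>"
    then have "fst a \<in> {1..n+1}" "snd a \<in> {1..n+1}" using that by blast+
    then show "a \<in> arrows n"
      using assms(2)[OF a] by (cases a) (auto simp: arrows_def forward_def backward_def)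
  qed
  then show ?thesis
    using assms(1)
    by (auto simp: saturated_faces_def Delta_def saturated_def pairwise_edges_def endpoints_Union)
qed

lemma forward_or_backward: "\<sigma> \<in> saturated_faces R n \<Longrightarrow> a \<in> \<sigma> \<Longrightarrow> forward a \<or> backward a"
  by (auto simp: saturated_faces_def Delta_def arrows_def forward_def backward_def)

text \<open>The pairs of arrows split into forward, backward and mixed ones. The conditions on
  endpoint sets combine to \<open>mixed_configs\<close>, which leaves one staircase condition for
  each direction.\<close>

lemma mixed_face_iff:
  assumes "n \<ge> 1" "F \<noteq> {}" "G \<noteq> {}" "\<And>a. a \<in> F \<Longrightarrow> forward a" "\<And>a. a \<in> G \<Longrightarrow> backward a"
  shows "F \<union> G \<in> saturated_faces R n \<longleftrightarrow>
    (fst ` F, snd ` F, fst ` G, snd ` G) \<in> mixed_configs (n + 1) \<and>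
    F \<in> staircases forward_order (fst ` F) (snd ` F) \<and>
    G \<in> staircases backward_order (fst ` G) (snd ` G)"
    (is "_ \<longleftrightarrow> ?cfg \<and> ?F \<and> ?G")
proof -
  let ?ltF = "\<forall>i\<in>fst ` F. \<forall>j\<in>snd ` F. i < j" and ?ltG = "\<forall>i\<in>snd ` G. \<forall>j\<in>fst ` G. i < j"
  let ?sep = "fst ` F \<inter> snd ` G = {} \<and> snd ` F \<inter> fst ` G = {} \<and>
    (\<forall>i\<in>fst ` F \<union> snd ` G. \<forall>j\<in>snd ` F \<union> fst ` G. i \<le> j)"
  let ?sat = "fst ` (F \<union> G) \<union> snd ` (F \<union> G) = {1..n+1}"
  have "F \<inter> G = {}" using assms(4,5) forward_not_backward by blast
  then have ne: "a \<noteq> b" if "a \<in> F" "b \<in> G" for a b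
    using that by auto
  have split: "pairwise_edges (F \<union> G) \<longleftrightarrow>
      pairwise_edges F \<and> pairwise_edges G \<and> (\<forall>a\<in>F. \<forall>b\<in>G. edge R a b)"
  proof
    assume "pairwise_edges (F \<union> G)"
    then show "pairwise_edges F \<and> pairwise_edges G \<and> (\<forall>a\<in>F. \<forall>b\<in>G. edge R a b)"
      using ne by (simp add: pairwise_edges_def)
  next
    assume r: "pairwise_edges F \<and> pairwise_edges G \<and> (\<forall>a\<in>F. \<forall>b\<in>G. edge R a b)"
    show "pairwise_edges (F \<union> G)"
      unfolding pairwise_edges_def
    proof (intro ballI impI)
      fix a b assume "a \<in> F \<union> G" "b \<in> F \<union> G" "a \<noteq> b"
      then show "edge R a b"
        using r edge_sym[of R a b] unfolding pairwise_edges_def by auto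
    qed
  qed
  have F: "pairwise_edges F \<longleftrightarrow> ?ltF \<and> ?F" and G: "pairwise_edges G \<longleftrightarrow> ?ltG \<and> ?G"
    using pairwise_edges_forward[OF assms(4)] pairwise_edges_backward[OF assms(5)] by simp_all
  \<comment> \<open>The mixed criterion holds only once tails and heads are separated within each
    direction; a propositional argument then combines all equivalences.\<close>
  have FG: "?ltF \<longrightarrow> ?ltG \<longrightarrow> ((\<forall>a\<in>F. \<forall>b\<in>G. edge R a b) \<longleftrightarrow> ?sep)"
    using forward_backward_edges[OF assms(2-5)] by (intro impI)
  have face: "F \<union> G \<in> saturated_faces R n \<longleftrightarrow> pairwise_edges (F \<union> G) \<and> ?sat"
    using assms(4,5) by (intro saturated_faces_iff[OF assms(1)]) blast
  have sat: "?sat \<longleftrightarrow> fst ` F \<union> snd ` F \<union> fst ` G \<union> snd ` G = {1..n+1}"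
    by (simp add: image_Un Un_ac)
  have cfg: "?cfg \<longleftrightarrow> ?ltF \<and> ?ltG \<and> ?sep \<and>
      fst ` F \<union> snd ` F \<union> fst ` G \<union> snd ` G = {1..n+1}"
    using assms(2,3) by (subst mixed_configs_iff) (simp_all only: image_is_empty conj_assoc not_False_eq_True)
  from split F G FG face sat cfg show ?thesis by argo
qed

definition face_weight :: "'a::comm_ring_1 \<Rightarrow> 'a \<Rightarrow> arrow set \<Rightarrow> 'a" where
  "face_weight x y \<sigma> = x ^ card {a \<in> \<sigma>. forward a} * y ^ card {a \<in> \<sigma>. backward a}"

text \<open>A mixed face corresponds to its four endpoint sets together with one staircase for each
  direction.\<close>

lemma sum_mixed_faces:
  fixes x y :: "'a::comm_ring_1"
  assumes "n \<ge> 1"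
  shows "(\<Sum>\<sigma> | \<sigma> \<in> saturated_faces R n \<and> (\<exists>a\<in>\<sigma>. forward a) \<and> (\<exists>a\<in>\<sigma>. backward a). face_weight x y \<sigma>) =
    (\<Sum>(A, B, A', B')\<in>mixed_configs (n + 1).
      staircase_poly (card A) (card B) x * staircase_poly (card A') (card B') y)"
proof -
  \<comment> \<open>\<open>S q\<close> is the fibre over the configuration \<open>q\<close>: the
    staircases are independent, so their weights multiply.\<close>
  define S where "S = (\<lambda>(A::nat set, B::nat set, A'::nat set, B'::nat set).
    staircases forward_order A B \<times> staircases backward_order A' B')"
  have fin: "finite A" "finite B" "finite A'" "finite B'" if "(A, B, A', B') \<in> mixed_configs (n + 1)"
    for A B A' B'
    using that mixed_configs_subset by (auto dest!: subsetD intro: finite_subset)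
  have "(\<Sum>(A, B, A', B')\<in>mixed_configs (n + 1).
      staircase_poly (card A) (card B) x * staircase_poly (card A') (card B') y) =
    (\<Sum>q\<in>mixed_configs (n + 1). \<Sum>(F, G)\<in>S q. x ^ card F * y ^ card G)"
  proof (intro sum.cong refl)
    fix q assume q: "q \<in> mixed_configs (n + 1)"
    obtain A B A' B' where q_eq: "q = (A, B, A', B')" by (cases q)
    note sums = sum_staircases[OF inj_orientation[of "R [Tail, Tail, Head, Head]"] fin(1,2)[OF q[unfolded q_eq]]]
      sum_staircases[OF inj_orientation[of "R [Head, Head, Tail, Tail]"] fin(3,4)[OF q[unfolded q_eq]]]
    show "(case q of (A, B, A', B') \<Rightarrow>
        staircase_poly (card A) (card B) x * staircase_poly (card A') (card B') y) =
      (\<Sum>(F, G)\<in>S q. x ^ card F * y ^ card G)"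
      unfolding q_eq S_def prod.case sums[symmetric] sum_product sum.cartesian_product ..
  qed
  also have "\<dots> = (\<Sum>(q, F, G)\<in>Sigma (mixed_configs (n + 1)) S. x ^ card F * y ^ card G)"
    using fin by (subst sum.Sigma)
      (auto simp: S_def finite_mixed_configs split_def intro!: finite_cartesian_product finite_staircases)
  also have "\<dots> = (\<Sum>\<sigma> | \<sigma> \<in> saturated_faces R n \<and> (\<exists>a\<in>\<sigma>. forward a) \<and> (\<exists>a\<in>\<sigma>. backward a). face_weight x y \<sigma>)"
    (is "_ = sum _ ?M")
  proof -
    let ?fw = "\<lambda>\<sigma>. {a \<in> \<sigma>. forward a}" and ?bw = "\<lambda>\<sigma>. {a \<in> \<sigma>. backward a}"
    let ?j = "\<lambda>\<sigma>. ((fst ` ?fw \<sigma>, snd ` ?fw \<sigma>, fst ` ?bw \<sigma>, snd ` ?bw \<sigma>), ?fw \<sigma>, ?bw \<sigma>)"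
    let ?i = "\<lambda>(q, F, G). F \<union> G"
    \<comment> \<open>A configuration places \<open>A\<close> before \<open>B\<close> and
      \<open>B'\<close> before \<open>A'\<close>, so the two staircases are recovered from their
      union by the directions of the arrows.\<close>
    have decompose: "?fw (F \<union> G) = F" "?bw (F \<union> G) = G" "F \<noteq> {}" "G \<noteq> {}"
        "\<And>a. a \<in> F \<Longrightarrow> forward a" "\<And>a. a \<in> G \<Longrightarrow> backward a"
      if c: "(A, B, A', B') \<in> mixed_configs (n + 1)" and F: "F \<in> staircases forward_order A B"
        and G: "G \<in> staircases backward_order A' B'" for A B A' B' F G
    proof -
      have ne: "A \<noteq> {}" "B \<noteq> {}" "A' \<noteq> {}" "B' \<noteq> {}"
        using c by (auto simp: mixed_configs_def)
      then show "F \<noteq> {}" "G \<noteq> {}" using F G by (auto simp: staircases_def)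
      have lt: "\<forall>i\<in>A. \<forall>j\<in>B. i < j" "\<forall>i\<in>B'. \<forall>j\<in>A'. i < j"
        using c mixed_configs_iff[OF ne] by simp_all
      show f: "forward a" if "a \<in> F" for a
        using subsetD[OF staircases_subset[OF F] that] lt(1) by (auto simp: forward_def)
      show b: "backward a" if "a \<in> G" for a
        using subsetD[OF staircases_subset[OF G] that] lt(2) by (auto simp: backward_def)
      show "?fw (F \<union> G) = F" "?bw (F \<union> G) = G"
        using f b forward_not_backward by blast+
    qed
    have rejoin: "?fw \<sigma> \<union> ?bw \<sigma> = \<sigma>" if "\<sigma> \<in> saturated_faces R n" for \<sigma>
      using forward_or_backward[OF that] by auto
    show ?thesis
    proof (rule sum.reindex_bij_witness[of _ ?j ?i])
      fix p assume "p \<in> Sigma (mixed_configs (n + 1)) S"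
      then obtain A B A' B' F G where p: "p = ((A, B, A', B'), F, G)"
        and c: "(A, B, A', B') \<in> mixed_configs (n + 1)" and F: "F \<in> staircases forward_order A B"
        and G: "G \<in> staircases backward_order A' B'"
        by (auto simp: S_def)
      note d = decompose[OF c F G]
      have im: "fst ` F = A" "snd ` F = B" "fst ` G = A'" "snd ` G = B'"
        using staircases_image[OF F] staircases_image[OF G] by simp_all
      show "?j (?i p) = p" unfolding p prod.case d(1,2) im ..
      have "F \<union> G \<in> saturated_faces R n"
        using mixed_face_iff[OF assms d(3-6)] c F G unfolding im by simp
      moreover have "\<exists>a\<in>F \<union> G. forward a" "\<exists>a\<in>F \<union> G. backward a" using d(3-6) by blast+
      ultimately show "?i p \<in> ?M" unfolding p by simp
      show "face_weight x y (?i p) = (case p of (q, F, G) \<Rightarrow> x ^ card F * y ^ card G)"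
        unfolding p prod.case face_weight_def d(1,2) ..
    next
      fix \<sigma> assume "\<sigma> \<in> ?M"
      then have \<sigma>: "\<sigma> \<in> saturated_faces R n" "?fw \<sigma> \<noteq> {}" "?bw \<sigma> \<noteq> {}" by auto
      show "?i (?j \<sigma>) = \<sigma>" using rejoin[OF \<sigma>(1)] by simp
      show "?j \<sigma> \<in> Sigma (mixed_configs (n + 1)) S"
        using mixed_face_iff[OF assms \<sigma>(2,3)] \<sigma>(1) unfolding rejoin[OF \<sigma>(1)] S_def by simp
    qed
  qed
  finally show ?thesis ..
qed

text \<open>All tails precede all heads and every vertex occurs, so the tails form an initial
  segment \<open>{1..p}\<close>, with at least one head left over.\<close>

lemma forward_faces_eq:
  assumes "n \<ge> 1"
  shows "{\<sigma> \<in> saturated_faces R n. \<forall>a\<in>\<sigma>. forward a} =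
    (\<Union>p\<in>{1..n}. staircases forward_order {1..p} {p+1..n+1})" (is "?l = ?r")
proof (intro equalityI subsetI)
  fix \<sigma> assume "\<sigma> \<in> ?l"
  then have fw: "\<And>a. a \<in> \<sigma> \<Longrightarrow> forward a" and "\<sigma> \<in> saturated_faces R n" by auto
  then have *: "\<forall>i\<in>fst ` \<sigma>. \<forall>j\<in>snd ` \<sigma>. i < j" "fst ` \<sigma> \<union> snd ` \<sigma> = {1..n+1}"
    and st: "\<sigma> \<in> staircases forward_order (fst ` \<sigma>) (snd ` \<sigma>)"
    using saturated_faces_iff[OF assms, of \<sigma>] pairwise_edges_forward[of \<sigma>] by blast+
  have "\<sigma> \<noteq> {}" using *(2) by auto
  then obtain p where p: "p \<in> {1..n}" "fst ` \<sigma> = {1..p}" "snd ` \<sigma> = {p+1..n+1}"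
    using split_interval_strict[OF _ _ *(2,1)] by auto
  then show "\<sigma> \<in> ?r" using st unfolding p(2,3) by blast
next
  fix \<sigma> assume "\<sigma> \<in> ?r"
  then obtain p where p: "p \<in> {1..n}" and st: "\<sigma> \<in> staircases forward_order {1..p} {p+1..n+1}"
    by blast
  have im: "fst ` \<sigma> = {1..p}" "snd ` \<sigma> = {p+1..n+1}" using staircases_image[OF st] by simp_all
  have fw: "forward a" if "a \<in> \<sigma>" for a
    using subsetD[OF staircases_subset[OF st] that] by (auto simp: forward_def)
  moreover have "pairwise_edges \<sigma>"
  proof -
    have "\<forall>i\<in>fst ` \<sigma>. \<forall>j\<in>snd ` \<sigma>. i < j" unfolding im by simp
    moreover have "\<sigma> \<in> staircases forward_order (fst ` \<sigma>) (snd ` \<sigma>)" unfolding im by (rule st)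
    ultimately show ?thesis using pairwise_edges_forward[of \<sigma>] fw by blast
  qed
  moreover have "fst ` \<sigma> \<union> snd ` \<sigma> = {1..n+1}" using p unfolding im by auto
  ultimately show "\<sigma> \<in> ?l" using saturated_faces_iff[OF assms] by blast
qed

lemma backward_faces_eq:
  assumes "n \<ge> 1"
  shows "{\<sigma> \<in> saturated_faces R n. \<forall>a\<in>\<sigma>. backward a} =
    (\<Union>p\<in>{1..n}. staircases backward_order {p+1..n+1} {1..p})" (is "?l = ?r")
proof (intro equalityI subsetI)
  fix \<sigma> assume "\<sigma> \<in> ?l"
  then have bw: "\<And>a. a \<in> \<sigma> \<Longrightarrow> backward a" and "\<sigma> \<in> saturated_faces R n" by auto
  then have *: "\<forall>i\<in>snd ` \<sigma>. \<forall>j\<in>fst ` \<sigma>. i < j" "snd ` \<sigma> \<union> fst ` \<sigma> = {1..n+1}"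
    and st: "\<sigma> \<in> staircases backward_order (fst ` \<sigma>) (snd ` \<sigma>)"
    using saturated_faces_iff[OF assms, of \<sigma>] pairwise_edges_backward[of \<sigma>] by blast+
  have "\<sigma> \<noteq> {}" using *(2) by auto
  then obtain p where p: "p \<in> {1..n}" "snd ` \<sigma> = {1..p}" "fst ` \<sigma> = {p+1..n+1}"
    using split_interval_strict[OF _ _ *(2,1)] by auto
  then show "\<sigma> \<in> ?r" using st unfolding p(2,3) by blast
next
  fix \<sigma> assume "\<sigma> \<in> ?r"
  then obtain p where p: "p \<in> {1..n}" and st: "\<sigma> \<in> staircases backward_order {p+1..n+1} {1..p}"
    by blast
  have im: "snd ` \<sigma> = {1..p}" "fst ` \<sigma> = {p+1..n+1}" using staircases_image[OF st] by simp_all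
  have bw: "backward a" if "a \<in> \<sigma>" for a
    using subsetD[OF staircases_subset[OF st] that] by (auto simp: backward_def)
  moreover have "pairwise_edges \<sigma>"
  proof -
    have "\<forall>i\<in>snd ` \<sigma>. \<forall>j\<in>fst ` \<sigma>. i < j" unfolding im by simp
    moreover have "\<sigma> \<in> staircases backward_order (fst ` \<sigma>) (snd ` \<sigma>)" unfolding im by (rule st)
    ultimately show ?thesis using pairwise_edges_backward[of \<sigma>] bw by blast
  qed
  moreover have "fst ` \<sigma> \<union> snd ` \<sigma> = {1..n+1}" using p unfolding im by auto
  ultimately show "\<sigma> \<in> ?l" using saturated_faces_iff[OF assms] by blast
qed

end

subsection \<open>Generating functions\<close>

lemma finite_arrows: "finite (arrows n)"
  by (rule finite_subset[of _ "{1..n+1} \<times> {1..n+1}"]) (auto simp: arrows_def)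

lemma finite_saturated_faces: "finite (saturated_faces R n)"
  by (rule finite_subset[of _ "Pow (arrows n)"])
    (auto simp: saturated_faces_def Delta_def finite_arrows)

text \<open>Only finitely many indices contribute to each coefficient, so the family is summable and
  any finite set containing the contributing indices computes the coefficient.\<close>

lemma fps_nth_infsum:
  fixes f :: "'i \<Rightarrow> 'a::ab_group_add fps"
  assumes "\<And>n. finite (T n)" "\<And>n. T n \<subseteq> A" "\<And>n i. i \<in> A - T n \<Longrightarrow> fps_nth (f i) n = 0"
  shows "fps_nth (infsum f A) n = (\<Sum>i\<in>T n. fps_nth (f i) n)"
proof -
  have sub: "{i \<in> A. fps_nth (f i) n \<noteq> 0} \<subseteq> T n" for n using assms(3) by blast
  have "(f has_sum Abs_fps (\<lambda>n. \<Sum>i | i \<in> A \<and> fps_nth (f i) n \<noteq> 0. fps_nth (f i) n)) A"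
    by (rule has_sum_fpsI) (use sub assms(1) in \<open>auto intro: finite_subset\<close>)
  then have "fps_nth (infsum f A) n = (\<Sum>i | i \<in> A \<and> fps_nth (f i) n \<noteq> 0. fps_nth (f i) n)"
    by (simp add: infsumI)
  also have "\<dots> = (\<Sum>i\<in>T n. fps_nth (f i) n)"
    using sub assms(1) subsetD[OF assms(2)] by (intro sum.mono_neutral_left) auto
  finally show ?thesis .
qed

text \<open>Put \<open>a = p - 1\<close> and \<open>b = n - p\<close>; padding with zeros to a box
  gives the shape of the truncated infinite sum.\<close>

lemma sum_initial_segments:
  fixes h :: "nat \<Rightarrow> nat \<Rightarrow> 'a::comm_monoid_add"
  shows "(\<Sum>p\<in>{1..n}. h p (n + 1 - p)) =
    (\<Sum>(a, b)\<in>{..n} \<times> {..n}. if n = a + b + 1 then h (Suc a) (Suc b) else 0)"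
proof -
  have "(\<Sum>p\<in>{1..n}. h p (n + 1 - p)) =
      (\<Sum>(a, b)\<in>{(a, b). n = a + b + 1}. h (Suc a) (Suc b))"
    by (rule sum.reindex_bij_witness[of _ "\<lambda>(a, b). Suc a" "\<lambda>p. (p - 1, n - p)"])
      (auto simp: Suc_diff_le)
  also have "\<dots> = (\<Sum>(a, b)\<in>{..n} \<times> {..n}. if n = a + b + 1 then h (Suc a) (Suc b) else 0)"
    by (rule sum.mono_neutral_cong_left) (auto split: if_splits)
  finally show ?thesis .
qed

section \<open>Coefficients of the face generating function\<close>

context nest_cross_rules
begin

lemma sum_forward_faces:
  assumes "n \<ge> 1"
  shows "(\<Sum>\<sigma> | \<sigma> \<in> saturated_faces R n \<and> (\<forall>a\<in>\<sigma>. forward a). face_weight x y \<sigma>) =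
    (\<Sum>(a, b)\<in>{..n} \<times> {..n}. if n = a + b + 1 then x * delannoy a b x else 0)"
proof -
  have "(\<Sum>\<sigma> | \<sigma> \<in> saturated_faces R n \<and> (\<forall>a\<in>\<sigma>. forward a). face_weight x y \<sigma>) =
      (\<Sum>\<sigma> | \<sigma> \<in> saturated_faces R n \<and> (\<forall>a\<in>\<sigma>. forward a). x ^ card \<sigma>)"
  proof (rule sum.cong[OF refl])
    fix \<sigma> assume "\<sigma> \<in> {\<sigma>. \<sigma> \<in> saturated_faces R n \<and> (\<forall>a\<in>\<sigma>. forward a)}"
    then have "{a \<in> \<sigma>. forward a} = \<sigma>" "{a \<in> \<sigma>. backward a} = {}"
      using forward_not_backward by blast+
    then show "face_weight x y \<sigma> = x ^ card \<sigma>" unfolding face_weight_def by (simp only: card.empty power_0 mult_1_left mult_1_right)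
  qed
  also have "\<dots> = (\<Sum>p\<in>{1..n}. \<Sum>\<sigma>\<in>staircases forward_order {1..p} {p+1..n+1}. x ^ card \<sigma>)"
    unfolding forward_faces_eq[OF assms]
    by (rule sum.UNION_disjoint)
      (auto intro!: finite_staircases dest!: staircases_image)
  also have "\<dots> = (\<Sum>p\<in>{1..n}. staircase_poly p (n + 1 - p) x)"
    by (simp add: sum_staircases[OF inj_orientation])
  finally show ?thesis
    by (simp only: sum_initial_segments[of "\<lambda>a b. staircase_poly a b x"] staircase_poly_Suc_Suc)
qed

lemma sum_backward_faces:
  assumes "n \<ge> 1"
  shows "(\<Sum>\<sigma> | \<sigma> \<in> saturated_faces R n \<and> (\<forall>a\<in>\<sigma>. backward a). face_weight x y \<sigma>) =
    (\<Sum>(a, b)\<in>{..n} \<times> {..n}. if n = a + b + 1 then y * delannoy a b y else 0)"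
proof -
  have "(\<Sum>\<sigma> | \<sigma> \<in> saturated_faces R n \<and> (\<forall>a\<in>\<sigma>. backward a). face_weight x y \<sigma>) =
      (\<Sum>\<sigma> | \<sigma> \<in> saturated_faces R n \<and> (\<forall>a\<in>\<sigma>. backward a). y ^ card \<sigma>)"
  proof (rule sum.cong[OF refl])
    fix \<sigma> assume "\<sigma> \<in> {\<sigma>. \<sigma> \<in> saturated_faces R n \<and> (\<forall>a\<in>\<sigma>. backward a)}"
    then have "{a \<in> \<sigma>. backward a} = \<sigma>" "{a \<in> \<sigma>. forward a} = {}"
      using forward_not_backward by blast+
    then show "face_weight x y \<sigma> = y ^ card \<sigma>" unfolding face_weight_def by (simp only: card.empty power_0 mult_1_left mult_1_right)
  qed
  also have "\<dots> = (\<Sum>p\<in>{1..n}. \<Sum>\<sigma>\<in>staircases backward_order {p+1..n+1} {1..p}. y ^ card \<sigma>)"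
    unfolding backward_faces_eq[OF assms]
    by (rule sum.UNION_disjoint)
      (auto intro!: finite_staircases dest!: staircases_image)
  also have "\<dots> = (\<Sum>p\<in>{1..n}. staircase_poly (n + 1 - p) p y)"
    by (simp add: sum_staircases[OF inj_orientation])
  \<comment> \<open>For backward arrows \<open>p\<close> counts the heads; reversing the range of
    \<open>p\<close> restores the order of the arguments.\<close>
  also have "\<dots> = (\<Sum>p\<in>{1..n}. staircase_poly p (n + 1 - p) y)"
    by (rule sum.reindex_bij_witness[of _ "\<lambda>p. n + 1 - p" "\<lambda>p. n + 1 - p"]) auto
  finally show ?thesis
    by (simp only: sum_initial_segments[of "\<lambda>a b. staircase_poly a b y"] staircase_poly_Suc_Suc)
qed

text \<open>Configurations are grouped by their sizes, on which alone the summand depends; every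
  size minus one is at most \<open>n\<close>.\<close>

lemma sum_mixed_configs:
  fixes x y :: "'a::comm_ring_1"
  shows "(\<Sum>(A, B, A', B')\<in>mixed_configs (n + 1).
      staircase_poly (card A) (card B) x * staircase_poly (card A') (card B') y) =
    (\<Sum>(a, b, c, d)\<in>{..n} \<times> {..n} \<times> {..n} \<times> {..n}.
      of_nat (card (sized_configs (n + 1) a b c d)) * (x * delannoy a b x * (y * delannoy c d y)))"
proof -
  let ?T = "{..n} \<times> {..n} \<times> {..n} \<times> {..n}"
  define h :: "nat set \<times> nat set \<times> nat set \<times> nat set \<Rightarrow> 'a" where "h = (\<lambda>(A, B, A', B').
    staircase_poly (card A) (card B) x * staircase_poly (card A') (card B') y)"
  define s :: "nat set \<times> nat set \<times> nat set \<times> nat set \<Rightarrow> nat \<times> nat \<times> nat \<times> nat" where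
    "s = (\<lambda>(A, B, A', B'). (card A - 1, card B - 1, card A' - 1, card B' - 1))"
  \<comment> \<open>Positive sizes make the truncated subtraction in \<open>s\<close>
    reversible.\<close>
  have pos: "0 < card A \<and> card A \<le> n + 1 \<and> 0 < card B \<and> card B \<le> n + 1 \<and>
      0 < card A' \<and> card A' \<le> n + 1 \<and> 0 < card B' \<and> card B' \<le> n + 1"
    if q: "(A, B, A', B') \<in> mixed_configs (n + 1)" for A B A' B'
  proof -
    have "A \<noteq> {}" "B \<noteq> {}" "A' \<noteq> {}" "B' \<noteq> {}"
      using q by (auto simp: mixed_configs_def)
    moreover have sub: "A \<subseteq> {1..n+1}" "B \<subseteq> {1..n+1}" "A' \<subseteq> {1..n+1}" "B' \<subseteq> {1..n+1}"
      using subsetD[OF mixed_configs_subset q] by auto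
    moreover have "finite A" "finite B" "finite A'" "finite B'"
      using sub by (auto intro: finite_subset)
    ultimately show ?thesis
      using card_mono[OF _ sub(1)] card_mono[OF _ sub(2)] card_mono[OF _ sub(3)] card_mono[OF _ sub(4)]
      by (simp add: card_gt_0_iff)
  qed
  have "s q \<in> ?T" if "q \<in> mixed_configs (n + 1)" for q
  proof -
    obtain A B A' B' where "q = (A, B, A', B')" by (cases q)
    then show ?thesis using pos[of A B A' B'] that by (auto simp: s_def)
  qed
  then have "s ` mixed_configs (n + 1) \<subseteq> ?T" by blast
  then have "sum h (mixed_configs (n + 1)) =
      (\<Sum>t\<in>?T. \<Sum>q | q \<in> mixed_configs (n + 1) \<and> s q = t. h q)"
    by (intro sum.group[symmetric] finite_mixed_configs) auto
  also have "\<dots> = (\<Sum>(a, b, c, d)\<in>?T.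
      of_nat (card (sized_configs (n + 1) a b c d)) * (x * delannoy a b x * (y * delannoy c d y)))"
  proof (rule sum.cong[OF refl])
    fix t assume "t \<in> ?T"
    obtain a b c d where t: "t = (a, b, c, d)" by (cases t)
    have "{q. q \<in> mixed_configs (n + 1) \<and> s q = t} = sized_configs (n + 1) a b c d" (is "?l = ?r")
    proof (intro equalityI subsetI)
      fix q assume q: "q \<in> ?l"
      obtain A B A' B' where "q = (A, B, A', B')" by (cases q)
      then show "q \<in> ?r" using q pos[of A B A' B'] by (auto simp: s_def t sized_configs_def)
    qed (auto simp: s_def t sized_configs_def)
    moreover have "h q = x * delannoy a b x * (y * delannoy c d y)"
      if "q \<in> sized_configs (n + 1) a b c d" for q
      using that by (auto simp: sized_configs_def h_def staircase_poly_Suc_Suc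
          simp del: staircase_poly.simps)
    ultimately show "(\<Sum>q | q \<in> mixed_configs (n + 1) \<and> s q = t. h q) =
        (case t of (a, b, c, d) \<Rightarrow>
          of_nat (card (sized_configs (n + 1) a b c d)) * (x * delannoy a b x * (y * delannoy c d y)))"
      by (simp add: t)
  qed
  finally show ?thesis unfolding h_def .
qed

lemma arrow_gf_nth:
  fixes x y :: "'a::comm_ring_1"
  assumes "n \<ge> 1"
  shows "fps_nth (arrow_gf (saturated_faces R) x y) n =
    (\<Sum>(a, b)\<in>{..n} \<times> {..n}. if n = a + b + 1 then x * delannoy a b x + y * delannoy a b y else 0) +
    (\<Sum>(a, b, c, d)\<in>{..n} \<times> {..n} \<times> {..n} \<times> {..n}.
      of_nat (card (sized_configs (n + 1) a b c d)) * (x * delannoy a b x * (y * delannoy c d y)))"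
proof -
  let ?S = "saturated_faces R n"
  let ?M = "{\<sigma>. \<sigma> \<in> ?S \<and> (\<exists>a\<in>\<sigma>. forward a) \<and> (\<exists>a\<in>\<sigma>. backward a)}"
  let ?F = "{\<sigma>. \<sigma> \<in> ?S \<and> (\<forall>a\<in>\<sigma>. forward a)}" and ?B = "{\<sigma>. \<sigma> \<in> ?S \<and> (\<forall>a\<in>\<sigma>. backward a)}"
  \<comment> \<open>The empty face would be both all forward and all backward; for
    \<open>n \<ge> 1\<close> it is not saturated.\<close>
  have "{} \<notin> ?S" using assms by (auto simp: saturated_faces_def saturated_def)
  then have ne: "\<exists>a. a \<in> \<sigma>" if "\<sigma> \<in> ?S" for \<sigma> using that by (cases "\<sigma> = {}") auto
  have "?S = ?F \<union> ?B \<union> ?M"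
    using forward_or_backward by blast
  moreover have "?F \<inter> ?B = {}" "(?F \<union> ?B) \<inter> ?M = {}"
    using ne forward_not_backward by blast+
  ultimately have "sum (face_weight x y) ?S =
      sum (face_weight x y) ?F + sum (face_weight x y) ?B + sum (face_weight x y) ?M"
    using finite_saturated_faces[of R n] by (metis (no_types, lifting) finite_Un sum.union_disjoint)
  moreover have "fps_nth (arrow_gf (saturated_faces R) x y) n = sum (face_weight x y) ?S"
    by (simp add: arrow_gf_def face_weight_def)
  moreover have "(\<Sum>(a, b)\<in>{..n} \<times> {..n}. if n = a + b + 1 then x * delannoy a b x else 0) +
      (\<Sum>(a, b)\<in>{..n} \<times> {..n}. if n = a + b + 1 then y * delannoy a b y else 0) =
      (\<Sum>(a, b)\<in>{..n} \<times> {..n}. if n = a + b + 1 then x * delannoy a b x + y * delannoy a b y else 0)"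
    unfolding sum.distrib[symmetric] by (rule sum.cong) auto
  ultimately show ?thesis
    unfolding sum_forward_faces[OF assms] sum_backward_faces[OF assms] sum_mixed_faces[OF assms]
      sum_mixed_configs by simp
qed

end

text \<open>With \<open>n + 1\<close> vertices, the count without a shared vertex sits at exponent
  \<open>a + b + c + d + 3\<close>, the term with \<open>fps_X\<close>, and the count with one at
  \<open>a + b + c + d + 2\<close>, the constant part.\<close>

lemma mixed_factor_nth:
  fixes r :: "'a::comm_ring_1"
  shows "fps_nth (fps_const r * fps_X ^ (a + b + c + d + 2) * mixed_factor a b c d) n =
    of_nat (card (sized_configs (n + 1) a b c d)) * r"
proof -
  have "mixed_factor a b c d =
      fps_const (of_nat (((a + d + 2) choose (a + 1)) * ((c + b + 2) choose (b + 1)))) * fps_X +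
      fps_const (of_nat (((a + d + 1) choose d) * ((c + b + 1) choose b) +
        ((a + d + 1) choose a) * ((c + b + 1) choose c)) :: 'a)"
    by (simp only: mixed_factor_def of_nat_mult of_nat_add fps_of_nat fps_const_mult[symmetric]
        fps_const_add[symmetric] add.assoc)
  then show ?thesis
    unfolding card_sized_configs mult.assoc
    by (auto simp: fps_X_power_mult_nth algebra_simps)
qed

section \<open>Comparison of coefficients\<close>

theorem theorem8p1:
  fixes R :: "arrow_end list \<Rightarrow> pattern"
    and x y :: "'a::comm_ring_1"
  assumes "rule_set R"
    and "R [Tail, Head, Tail, Head] = Nest" and "R [Head, Tail, Head, Tail] = Nest"
    and "R [Head, Tail, Tail, Head] = Cross" and "R [Tail, Head, Head, Tail] = Cross"
    and "\<And>n. n \<ge> 1 \<Longrightarrow>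
           triangulates (Delta R n) arrow_point (rel_frontier (legendre_polytope n))"
  shows "arrow_gf (saturated_faces R) x y =
    1 + (\<Sum>\<^sub>\<infinity>(a, b)\<in>UNIV.
           fps_const (x * delannoy a b x + y * delannoy a b y) * fps_X ^ (a + b + 1))
      + fps_const (x * y) *
        (\<Sum>\<^sub>\<infinity>(a', b', a'', b'')\<in>UNIV.
           fps_const (delannoy a' b' x * delannoy a'' b'' y) *
           fps_X ^ (a' + b' + a'' + b'' + 2) * mixed_factor a' b' a'' b'')"
proof (rule fps_ext)
  fix n
  interpret nest_cross_rules R by standard (fact assms)+
  let ?f = "\<lambda>(a, b). fps_const (x * delannoy a b x + y * delannoy a b y) * fps_X ^ (a + b + 1)"
  let ?g = "\<lambda>(a, b, c, d). fps_const (delannoy a b x * delannoy c d y) *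
    fps_X ^ (a + b + c + d + 2) * mixed_factor a b c d"
  have f: "fps_nth (?f (a, b)) n =
      (if n = a + b + 1 then x * delannoy a b x + y * delannoy a b y else 0)" for a b n
    by (auto simp add: fps_X_power_mult_right_nth simp del: power_Suc)
  have g: "fps_nth (?g (a, b, c, d)) n =
      of_nat (card (sized_configs (n + 1) a b c d)) * (delannoy a b x * delannoy c d y)" for a b c d n
    unfolding prod.case by (rule mixed_factor_nth)
  \<comment> \<open>Indices outside the box exceed \<open>n\<close> in some component, hence
    contribute nothing to the coefficient of degree \<open>n\<close>.\<close>
  have sf: "fps_nth (infsum ?f UNIV) n = (\<Sum>i\<in>{..n} \<times> {..n}. fps_nth (?f i) n)"
  proof (rule fps_nth_infsum)
    fix n and i :: "nat \<times> nat" assume "i \<in> UNIV - {..n} \<times> {..n}"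
    then show "fps_nth (?f i) n = 0" by (cases i) (simp only: f, auto)
  qed auto
  have sg: "fps_nth (infsum ?g UNIV) n = (\<Sum>i\<in>{..n} \<times> {..n} \<times> {..n} \<times> {..n}. fps_nth (?g i) n)"
  proof (rule fps_nth_infsum)
    fix n and i :: "nat \<times> nat \<times> nat \<times> nat" assume "i \<in> UNIV - {..n} \<times> {..n} \<times> {..n} \<times> {..n}"
    then show "fps_nth (?g i) n = 0" by (cases i) (simp only: g, auto simp: card_sized_configs)
  qed auto
  have "fps_nth (1 + infsum ?f UNIV + fps_const (x * y) * infsum ?g UNIV) n =
      (if n = 0 then 1 else 0) +
      (\<Sum>(a, b)\<in>{..n} \<times> {..n}. if n = a + b + 1 then x * delannoy a b x + y * delannoy a b y else 0) +
      (\<Sum>(a, b, c, d)\<in>{..n} \<times> {..n} \<times> {..n} \<times> {..n}.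
        of_nat (card (sized_configs (n + 1) a b c d)) * (x * delannoy a b x * (y * delannoy c d y)))"
  proof -
    have "fps_nth (infsum ?f UNIV) n =
        (\<Sum>(a, b)\<in>{..n} \<times> {..n}. if n = a + b + 1 then x * delannoy a b x + y * delannoy a b y else 0)"
      unfolding sf by (intro sum.cong refl) (use f in \<open>simp add: split_paired_all\<close>)
    moreover have "x * y * fps_nth (infsum ?g UNIV) n =
        (\<Sum>(a, b, c, d)\<in>{..n} \<times> {..n} \<times> {..n} \<times> {..n}.
          of_nat (card (sized_configs (n + 1) a b c d)) * (x * delannoy a b x * (y * delannoy c d y)))"
      unfolding sg sum_distrib_left
    proof (intro sum.cong refl)
      fix i :: "nat \<times> nat \<times> nat \<times> nat"
      obtain a b c d where i: "i = (a, b, c, d)" by (cases i)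
      show "x * y * fps_nth (?g i) n = (case i of (a, b, c, d) \<Rightarrow>
          of_nat (card (sized_configs (n + 1) a b c d)) * (x * delannoy a b x * (y * delannoy c d y)))"
        unfolding i g unfolding prod.case by (simp add: ac_simps)
    qed
    ultimately show ?thesis by simp
  qed
  also have "\<dots> = fps_nth (arrow_gf (saturated_faces R) x y) n"
  \<comment> \<open>In degree 0 only the empty face counts, which is the summand 1; both sums
    vanish, as their terms have degree at least 1 and 2.\<close>
  proof (cases "n = 0")
    case True
    have "saturated_faces R 0 = {{}}"
      by (auto simp: saturated_faces_def saturated_def Delta_def)
    with True show ?thesis by (simp add: arrow_gf_def card_sized_configs)
  next
    case False
    then show ?thesis using arrow_gf_nth[of n x y] by simp
  qed
  finally show "fps_nth (arrow_gf (saturated_faces R) x y) n =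
    fps_nth (1 + infsum ?f UNIV + fps_const (x * y) * infsum ?g UNIV) n" ..
qed

end
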